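(* Let $(x_0,y_0)\in\mathbb{R}^2$. For every $f\in\mathcal{R}_{(x_0,y_0)}$ and every $d\in D_f(x_0,y_0)$ there exists a character $\chi\in X^1_{(x_0,y_0)}$ such that $\chi(f)=d$.
   Context: A rational function of two real arguments is $f=p/q$ with $p,q$ mutually prime real polynomials in $x,y$, $q\neq 0$; $\mathcal{R}$ is the set of all of them. Convention: whenever the iterated limit $\lim_{x\to x_0}\lim_{y\to y_0}f(x,y)$ is finite, one sets $f(x_0,y_0)$ equal to it. $\mathcal{R}_{(x_0,y_0)}$ is the commutative real algebra (pointwise operations) of all $f\in\mathcal{R}$ that are bounded in some neighbourhood of $(x_0,y_0)$. The set of limiting values of $f$ at $(x_0,y_0)$ is $D_f(x_0,y_0)=\bigcap_V \overline{f(V)}$, where $V$ ranges over all neighbourhoods of $(x_0,y_0)$. A character of a real algebra is a nontrivial homomorphism into $\mathbb{R}$. A net $\{(x_\gamma,y_\gamma)\}_{\gamma\in\Gamma}$ converging to $(x_0,y_0)$ in $\mathbb{R}^2$ determines the character $\chi$ of $\mathcal{R}_{(x_0,y_0)}$ if for every $f\in\mathcal{R}_{(x_0,y_0)}$ the limit $\lim_\gamma f(x_\gamma,y_\gamma)$ exists, is finite, and equals $\chi(f)$. A function of type $\mathcal{I}$ is $\Phi_N(t)=\sum_{k=1}^N\phi_k|t|^{e_k}$ with $N\in\mathbb{Z}^+=\{0,1,2,\dots\}$, $\phi_k\in\mathbb{R}\setminus\{0\}$, $e_k\in\mathbb{Q}$, $1\le e_1<\dots<e_N$ (and $\Phi_0(t)=0$).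 $X^1_{(x_0,y_0)}$ is the set of characters of $\mathcal{R}_{(x_0,y_0)}$ determined by nets converging to $(x_0,y_0)$ and satisfying one of the following: (a) either $x_\gamma>x_0$ for all $\gamma$ or $x_\gamma<x_0$ for all $\gamma$; the limit $\lim_\gamma\frac{y_\gamma-y_0}{x_\gamma-x_0}$ exists and is finite; and there is $\Phi_N$ of type $\mathcal{I}$ such that $\lim_\gamma\frac{y_\gamma-y_0-\Phi_N(x_\gamma-x_0)}{|x_\gamma-x_0|^e}=0$ for all $e\in\mathbb{R}$; (b) either $y_\gamma>y_0$ for all $\gamma$ or $y_\gamma<y_0$ for all $\gamma$; the limit $\lim_\gamma\frac{x_\gamma-x_0}{y_\gamma-y_0}$ exists and is finite; and there is $\Phi_N$ of type $\mathcal{I}$ such that $\lim_\gamma\frac{x_\gamma-x_0-\Phi_N(y_\gamma-y_0)}{|y_\gamma-y_0|^e}=0$ for all $e\in\mathbb{R}$. *)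

theory Defs
  imports "HOL-Analysis.Analysis" "HOL-Computational_Algebra.Computational_Algebra"
    "HOL-Computational_Algebra.Field_as_Ring"
begin

section \<open>Rational functions of two real arguments\<close>

(* A polynomial in x and y is an element of R[x][y]: the outer variable is y and the coefficients
   are polynomials in x. *)
type_synonym poly_xy = "real poly poly"

definition ev :: "poly_xy \<Rightarrow> real \<times> real \<Rightarrow> real" where
  "ev p z = poly (poly p [:snd z:]) (fst z)"

(* The set of all rational functions is the type ratfun, the fraction field of R[x][y].  Every
   element has a representation p/q with p, q coprime and q nonzero; quot_of_fract picks the
   one with q normalized, which only fixes a nonzero real factor common to p and q. *)
type_synonym ratfun = "real poly poly fract"

definition numer :: "ratfun \<Rightarrow> poly_xy" where
  "numer f = fst (quot_of_fract f)"

definition denom :: "ratfun \<Rightarrow> poly_xy" where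
  "denom f = snd (quot_of_fract f)"

lemma numer_denom:
  shows denom_nonzero: "denom f \<noteq> 0"
    and coprime_numer_denom: "coprime (numer f) (denom f)"
    and Fract_numer_denom: "Fract (numer f) (denom f) = f"
proof -
  have "quot_of_fract f \<in> normalized_fracts" by simp
  then show "coprime (numer f) (denom f)"
    unfolding numer_def denom_def normalized_fracts_def by auto
qed (simp_all add: numer_def denom_def)

definition const_rf :: "real \<Rightarrow> ratfun" where
  "const_rf c = to_fract [:[:c:]:]"

(* L is the iterated limit of f, first y \<rightarrow> y0, then x \<rightarrow> x0.  The junk value of the quotient at zeros
   of the denominator is harmless: for all but finitely many x, the denominator does not vanish for
   y near y0, y \<noteq> y0 (see eventually_ev_nonzero below). *)
definition has_iterated_limit :: "ratfun \<Rightarrow> real \<times> real \<Rightarrow> real \<Rightarrow> bool" where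
  "has_iterated_limit f z L \<longleftrightarrow>
     (\<exists>g. (\<forall>\<^sub>F x in at (fst z).
             ((\<lambda>y. ev (numer f) (x, y) / ev (denom f) (x, y)) \<longlongrightarrow> g x) (at (snd z)))
        \<and> (g \<longlongrightarrow> L) (at (fst z)))"

definition rf_dom :: "ratfun \<Rightarrow> (real \<times> real) set" where
  "rf_dom f = {z. ev (denom f) z \<noteq> 0 \<or> (\<exists>L. has_iterated_limit f z L)}"

(* The value of f at z, meaningful for z in rf_dom f. *)
definition rf_val :: "ratfun \<Rightarrow> real \<times> real \<Rightarrow> real" where
  "rf_val f z =
     (if ev (denom f) z \<noteq> 0 then ev (numer f) z / ev (denom f) z
      else (THE L. has_iterated_limit f z L))"

definition nbhds_of :: "real \<times> real \<Rightarrow> (real \<times> real) set set" where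
  "nbhds_of z = {V. z \<in> interior V}"

(* Carrier of the algebra of rational functions bounded near z.  Its operations are those of
   ratfun, with scalar multiplication by c being multiplication by const_rf c; they are
   pointwise by rf_val_add, rf_val_mult and rf_val_const below. *)
definition bounded_rf :: "real \<times> real \<Rightarrow> ratfun set" where
  "bounded_rf z = {f. \<exists>U \<in> nbhds_of z. bounded (rf_val f ` (U \<inter> rf_dom f))}"

definition limiting_values :: "ratfun \<Rightarrow> real \<times> real \<Rightarrow> real set" where
  "limiting_values f z = (\<Inter>V \<in> nbhds_of z. closure (rf_val f ` (V \<inter> rf_dom f)))"


section \<open>Characters\<close>

definition is_character :: "ratfun set \<Rightarrow> (ratfun \<Rightarrow> real) \<Rightarrow> bool" where
  "is_character A \<xi> \<longleftrightarrow>
     \<xi> \<in> extensional A \<and>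
     (\<forall>f \<in> A. \<forall>g \<in> A. \<xi> (f + g) = \<xi> f + \<xi> g) \<and>
     (\<forall>f \<in> A. \<forall>g \<in> A. \<xi> (f * g) = \<xi> f * \<xi> g) \<and>
     (\<forall>c. \<forall>f \<in> A. \<xi> (const_rf c * f) = c * \<xi> f) \<and>
     (\<exists>f \<in> A. \<xi> f \<noteq> 0)"


section \<open>Nets\<close>

definition directed :: "'i set \<Rightarrow> ('i \<Rightarrow> 'i \<Rightarrow> bool) \<Rightarrow> bool" where
  "directed \<Gamma> le \<longleftrightarrow>
     \<Gamma> \<noteq> {} \<and>
     (\<forall>\<alpha> \<in> \<Gamma>. le \<alpha> \<alpha>) \<and>
     (\<forall>\<alpha> \<in> \<Gamma>. \<forall>\<beta> \<in> \<Gamma>. \<forall>\<gamma> \<in> \<Gamma>. le \<alpha> \<beta> \<longrightarrow> le \<beta> \<gamma> \<longrightarrow> le \<alpha> \<gamma>) \<and>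
     (\<forall>\<alpha> \<in> \<Gamma>. \<forall>\<beta> \<in> \<Gamma>. \<exists>\<gamma> \<in> \<Gamma>. le \<alpha> \<gamma> \<and> le \<beta> \<gamma>)"

(* The filter of tails of a directed set; a limit along the net is a limit along this filter. *)
definition tails :: "'i set \<Rightarrow> ('i \<Rightarrow> 'i \<Rightarrow> bool) \<Rightarrow> 'i filter" where
  "tails \<Gamma> le = (INF \<alpha> \<in> \<Gamma>. principal {\<beta> \<in> \<Gamma>. le \<alpha> \<beta>})"

(* Values outside rf_dom do not matter here: a bounded rational function is defined on a whole
   neighbourhood of z (its slices through a nearby point are bounded rational functions of one
   variable, so the iterated limit there is finite), and the nets considered converge to z. *)
definition determines ::
    "'i filter \<Rightarrow> ('i \<Rightarrow> real) \<Rightarrow> ('i \<Rightarrow> real) \<Rightarrow> real \<times> real \<Rightarrow> (ratfun \<Rightarrow> real) \<Rightarrow> bool" where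
  "determines F x y z \<xi> \<longleftrightarrow>
     (\<forall>f \<in> bounded_rf z. ((\<lambda>\<gamma>. rf_val f (x \<gamma>, y \<gamma>)) \<longlongrightarrow> \<xi> f) F)"

definition type_I :: "(real \<Rightarrow> real) \<Rightarrow> bool" where
  "type_I \<Phi> \<longleftrightarrow>
     (\<exists>(N::nat) (\<phi> :: nat \<Rightarrow> real) (e :: nat \<Rightarrow> real).
        (\<forall>k \<in> {1..N}. \<phi> k \<noteq> 0 \<and> e k \<in> \<rat> \<and> 1 \<le> e k) \<and>
        strict_mono_on {1..N} e \<and>
        (\<forall>t. \<Phi> t = (\<Sum>k = 1..N. \<phi> k * \<bar>t\<bar> powr e k)))"

(* The net u approaches u0 from one side and the net v is close to v0 + \<Phi> (u - u0). *)
definition approach ::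
    "'i set \<Rightarrow> ('i \<Rightarrow> 'i \<Rightarrow> bool) \<Rightarrow> ('i \<Rightarrow> real) \<Rightarrow> ('i \<Rightarrow> real) \<Rightarrow> real \<Rightarrow> real \<Rightarrow> bool" where
  "approach \<Gamma> le u v u0 v0 \<longleftrightarrow>
     ((\<forall>\<gamma> \<in> \<Gamma>. u \<gamma> > u0) \<or> (\<forall>\<gamma> \<in> \<Gamma>. u \<gamma> < u0)) \<and>
     (\<exists>m. ((\<lambda>\<gamma>. (v \<gamma> - v0) / (u \<gamma> - u0)) \<longlongrightarrow> m) (tails \<Gamma> le)) \<and>
     (\<exists>\<Phi>. type_I \<Phi> \<and>
        (\<forall>e::real. ((\<lambda>\<gamma>. (v \<gamma> - v0 - \<Phi> (u \<gamma> - u0)) / \<bar>u \<gamma> - u0\<bar> powr e) \<longlongrightarrow> 0) (tails \<Gamma> le)))"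

definition X1_net ::
    "'i set \<Rightarrow> ('i \<Rightarrow> 'i \<Rightarrow> bool) \<Rightarrow> ('i \<Rightarrow> real) \<Rightarrow> ('i \<Rightarrow> real) \<Rightarrow> real \<times> real \<Rightarrow>
     (ratfun \<Rightarrow> real) \<Rightarrow> bool" where
  "X1_net \<Gamma> le x y z \<xi> \<longleftrightarrow>
     directed \<Gamma> le \<and>
     ((\<lambda>\<gamma>. (x \<gamma>, y \<gamma>)) \<longlongrightarrow> z) (tails \<Gamma> le) \<and>
     determines (tails \<Gamma> le) x y z \<xi> \<and>
     (approach \<Gamma> le x y (fst z) (snd z) \<or> approach \<Gamma> le y x (snd z) (fst z))"

(* Nets may have index sets of any type, and a formula cannot quantify over types.  It is
   enough to take indices of the following type: by X1_I below, nets over any other type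
   determine the same characters. *)
type_synonym net_index = "(real \<times> real) \<times> (real \<times> real) set"

definition X1 :: "real \<times> real \<Rightarrow> (ratfun \<Rightarrow> real) set" where
  "X1 z = {\<xi>. is_character (bounded_rf z) \<xi> \<and>
             (\<exists>(\<Gamma> :: net_index set) le x y. X1_net \<Gamma> le x y z \<xi>)}"


section \<open>The operations are pointwise\<close>

lemma ev_simps [simp]:
  "ev 0 z = 0" "ev 1 z = 1" "ev (p + q) z = ev p z + ev q z" "ev (p * q) z = ev p z * ev q z"
  "ev [:[:c:]:] z = c"
  by (simp_all add: ev_def)

lemma continuous_ev: "continuous_on UNIV (ev p)"
proof -
  have "continuous_on UNIV (\<lambda>z. poly (poly p [:snd z:]) (fst z :: real))"
  proof (induction p)
    case (pCons a p)
    then show ?case by (auto intro!: continuous_intros)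
  qed auto
  then show ?thesis by (simp add: ev_def[abs_def])
qed

lemma ev_slice: "ev p (x, y) = poly (map_poly (\<lambda>c. poly c x) p) y"
proof -
  have "poly (poly p [:y:]) x = poly (map_poly (\<lambda>c. poly c x) p) y"
    by (induction p) (auto simp: map_poly_pCons)
  then show ?thesis by (simp add: ev_def)
qed

lemma eventually_poly_nonzero:
  fixes p :: "real poly"
  assumes "p \<noteq> 0"
  shows "\<forall>\<^sub>F x in at a. poly p x \<noteq> 0"
proof -
  have "finite {x. poly p x = 0}" using assms by (rule poly_roots_finite)
  then have "open (- ({x. poly p x = 0} - {a}))"
    by (intro open_Compl finite_imp_closed) auto
  then show ?thesis
    unfolding eventually_at_topological by (intro exI[of _ "- ({x. poly p x = 0} - {a})"]) auto
qed

lemma eventually_ev_nonzero: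
  assumes "p \<noteq> 0"
  shows "\<forall>\<^sub>F x in at a. \<forall>\<^sub>F y in at b. ev p (x, y) \<noteq> 0"
proof -
  have "lead_coeff p \<noteq> 0" using assms by simp
  then have "\<forall>\<^sub>F x in at a. poly (lead_coeff p) x \<noteq> 0" by (rule eventually_poly_nonzero)
  then show ?thesis
  proof (rule eventually_mono)
    fix x assume "poly (lead_coeff p) x \<noteq> 0"
    then have "coeff (map_poly (\<lambda>c. poly c x) p) (degree p) \<noteq> 0"
      by (simp add: coeff_map_poly)
    then have "map_poly (\<lambda>c. poly c x) p \<noteq> 0" by auto
    from eventually_poly_nonzero[OF this] show "\<forall>\<^sub>F y in at b. ev p (x, y) \<noteq> 0"
      by (simp add: ev_slice)
  qed
qed

lemma has_iterated_limit_unique: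
  assumes "has_iterated_limit f z L" "has_iterated_limit f z M"
  shows "L = M"
proof -
  obtain g where g: "\<forall>\<^sub>F x in at (fst z).
      ((\<lambda>y. ev (numer f) (x, y) / ev (denom f) (x, y)) \<longlongrightarrow> g x) (at (snd z))"
    and gL: "(g \<longlongrightarrow> L) (at (fst z))"
    using assms(1) unfolding has_iterated_limit_def by blast
  obtain h where h: "\<forall>\<^sub>F x in at (fst z).
      ((\<lambda>y. ev (numer f) (x, y) / ev (denom f) (x, y)) \<longlongrightarrow> h x) (at (snd z))"
    and hM: "(h \<longlongrightarrow> M) (at (fst z))"
    using assms(2) unfolding has_iterated_limit_def by blast
  from g h have "\<forall>\<^sub>F x in at (fst z). g x = h x"
    by eventually_elim (rule tendsto_unique[OF at_neq_bot])
  from tendsto_cong[OF this] gL have "(h \<longlongrightarrow> L) (at (fst z))" by simp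
  from tendsto_unique[OF at_neq_bot this hM] show ?thesis .
qed

lemma has_iterated_limit_quotient:
  assumes "ev (denom f) z \<noteq> 0"
  shows "has_iterated_limit f z (ev (numer f) z / ev (denom f) z)"
proof -
  obtain a b where z: "z = (a, b)" by (cases z)
  have slice_y: "isCont (\<lambda>y. ev p (x, y)) b" for p x
    by (simp add: ev_slice)
  have slice_x: "isCont (\<lambda>x. ev p (x, b)) a" for p
    by (simp add: ev_def)
  have "\<forall>\<^sub>F x in at a. ev (denom f) (x, b) \<noteq> 0"
    using tendsto_imp_eventually_ne[OF slice_x[of "denom f", unfolded isCont_def]] assms z by simp
  then have "\<forall>\<^sub>F x in at a. ((\<lambda>y. ev (numer f) (x, y) / ev (denom f) (x, y))
      \<longlongrightarrow> ev (numer f) (x, b) / ev (denom f) (x, b)) (at b)"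
    by eventually_elim (intro tendsto_divide slice_y[unfolded isCont_def])
  moreover have "((\<lambda>x. ev (numer f) (x, b) / ev (denom f) (x, b))
      \<longlongrightarrow> ev (numer f) (a, b) / ev (denom f) (a, b)) (at a)"
    using assms z by (intro tendsto_divide slice_x[unfolded isCont_def]) auto
  ultimately show ?thesis
    unfolding has_iterated_limit_def z
    by (intro exI[of _ "\<lambda>x. ev (numer f) (x, b) / ev (denom f) (x, b)"]) simp
qed

lemma has_iterated_limit_rf_val:
  assumes "z \<in> rf_dom f"
  shows "has_iterated_limit f z (rf_val f z)"
proof (cases "ev (denom f) z = 0")
  case True
  then obtain L where L: "has_iterated_limit f z L" using assms by (auto simp: rf_dom_def)
  then have "(THE L. has_iterated_limit f z L) = L"
    using has_iterated_limit_unique by blast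
  then show ?thesis using True L by (simp add: rf_val_def)
qed (simp add: rf_val_def has_iterated_limit_quotient)

lemma rf_val_eqI:
  assumes "has_iterated_limit f z L"
  shows "z \<in> rf_dom f" "rf_val f z = L"
proof -
  show z: "z \<in> rf_dom f" using assms by (auto simp: rf_dom_def)
  show "rf_val f z = L"
    using has_iterated_limit_unique[OF has_iterated_limit_rf_val[OF z] assms] .
qed

lemma has_iterated_limit_combine:
  assumes "has_iterated_limit f z L" "has_iterated_limit g z M"
    and lim: "\<And>(a::real \<Rightarrow> real) b A B c. (a \<longlongrightarrow> A) (at c) \<Longrightarrow> (b \<longlongrightarrow> B) (at c) \<Longrightarrow>
               ((\<lambda>t. C (a t) (b t)) \<longlongrightarrow> C A B) (at (c::real))"
    and eq: "\<And>w. ev (denom f) w \<noteq> 0 \<Longrightarrow> ev (denom g) w \<noteq> 0 \<Longrightarrow> ev (denom h) w \<noteq> 0 \<Longrightarrow>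
      ev (numer h) w / ev (denom h) w =
      C (ev (numer f) w / ev (denom f) w) (ev (numer g) w / ev (denom g) w)"
  shows "has_iterated_limit h z (C L M)"
proof -
  obtain u where u: "\<forall>\<^sub>F x in at (fst z).
      ((\<lambda>y. ev (numer f) (x, y) / ev (denom f) (x, y)) \<longlongrightarrow> u x) (at (snd z))"
    and uL: "(u \<longlongrightarrow> L) (at (fst z))"
    using assms(1) unfolding has_iterated_limit_def by blast
  obtain v where v: "\<forall>\<^sub>F x in at (fst z).
      ((\<lambda>y. ev (numer g) (x, y) / ev (denom g) (x, y)) \<longlongrightarrow> v x) (at (snd z))"
    and vM: "(v \<longlongrightarrow> M) (at (fst z))"
    using assms(2) unfolding has_iterated_limit_def by blast
  have nz: "\<forall>\<^sub>F x in at (fst z). \<forall>\<^sub>F y in at (snd z). ev (denom k) (x, y) \<noteq> 0" for k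
    by (rule eventually_ev_nonzero[OF denom_nonzero])
  have "\<forall>\<^sub>F x in at (fst z).
      ((\<lambda>y. ev (numer h) (x, y) / ev (denom h) (x, y)) \<longlongrightarrow> C (u x) (v x)) (at (snd z))"
    using u v nz[of f] nz[of g] nz[of h]
  proof eventually_elim
    case (elim x)
    have "\<forall>\<^sub>F y in at (snd z).
      C (ev (numer f) (x, y) / ev (denom f) (x, y)) (ev (numer g) (x, y) / ev (denom g) (x, y))
      = ev (numer h) (x, y) / ev (denom h) (x, y)"
      using elim(3-5) by eventually_elim (rule eq[symmetric])
    from tendsto_cong[OF this] lim[OF elim(1,2)] show ?case by simp
  qed
  then show ?thesis
    unfolding has_iterated_limit_def
    by (intro exI[of _ "\<lambda>x. C (u x) (v x)"] conjI lim[OF uL vM])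
qed

lemma ev_cross:
  assumes "Fract a b = Fract c d" "b \<noteq> 0" "d \<noteq> 0" "ev b w \<noteq> 0" "ev d w \<noteq> 0"
  shows "ev a w / ev b w = ev c w / ev d w"
proof -
  have "a * d = c * b" using assms by (simp add: eq_fract)
  then have "ev a w * ev d w = ev c w * ev b w" by (metis ev_simps(4))
  then show ?thesis using assms by (simp add: frac_eq_eq)
qed

lemma rf_val_add:
  assumes "z \<in> rf_dom f" "z \<in> rf_dom g"
  shows "z \<in> rf_dom (f + g)" "rf_val (f + g) z = rf_val f z + rf_val g z"
proof -
  have "Fract (numer (f + g)) (denom (f + g)) =
      Fract (numer f * denom g + numer g * denom f) (denom f * denom g)"
    by (metis Fract_numer_denom add_fract denom_nonzero)
  note cross = ev_cross[OF this denom_nonzero]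
  have "has_iterated_limit (f + g) z (rf_val f z + rf_val g z)"
  proof (rule has_iterated_limit_combine[OF assms[THEN has_iterated_limit_rf_val]])
    fix w assume "ev (denom f) w \<noteq> 0" "ev (denom g) w \<noteq> 0" "ev (denom (f + g)) w \<noteq> 0"
    then show "ev (numer (f + g)) w / ev (denom (f + g)) w =
        ev (numer f) w / ev (denom f) w + ev (numer g) w / ev (denom g) w"
      using cross[of w] denom_nonzero by (simp add: add_frac_eq)
  qed (rule tendsto_add)
  then show "z \<in> rf_dom (f + g)" "rf_val (f + g) z = rf_val f z + rf_val g z"
    by (rule rf_val_eqI)+
qed

lemma rf_val_mult:
  assumes "z \<in> rf_dom f" "z \<in> rf_dom g"
  shows "z \<in> rf_dom (f * g)" "rf_val (f * g) z = rf_val f z * rf_val g z"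
proof -
  have "Fract (numer (f * g)) (denom (f * g)) = Fract (numer f * numer g) (denom f * denom g)"
    by (metis Fract_numer_denom mult_fract)
  note cross = ev_cross[OF this denom_nonzero]
  have "has_iterated_limit (f * g) z (rf_val f z * rf_val g z)"
  proof (rule has_iterated_limit_combine[OF assms[THEN has_iterated_limit_rf_val]])
    fix w assume "ev (denom f) w \<noteq> 0" "ev (denom g) w \<noteq> 0" "ev (denom (f * g)) w \<noteq> 0"
    then show "ev (numer (f * g)) w / ev (denom (f * g)) w =
        ev (numer f) w / ev (denom f) w * (ev (numer g) w / ev (denom g) w)"
      using cross[of w] denom_nonzero by simp
  qed (rule tendsto_mult)
  then show "z \<in> rf_dom (f * g)" "rf_val (f * g) z = rf_val f z * rf_val g z"
    by (rule rf_val_eqI)+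
qed

lemma rf_val_const: "z \<in> rf_dom (const_rf c)" "rf_val (const_rf c) z = c"
proof -
  have d: "denom (const_rf c) = 1"
    by (simp add: denom_def const_rf_def to_fract_def snd_quot_of_fract_Fract_whole)
  have "Fract (numer (const_rf c)) (denom (const_rf c)) = Fract [:[:c:]:] 1"
    by (simp add: Fract_numer_denom) (simp add: const_rf_def to_fract_def)
  from ev_cross[OF this] d have "ev (numer (const_rf c)) z = c" by simp
  then show "z \<in> rf_dom (const_rf c)" "rf_val (const_rf c) z = c"
    using d by (simp_all add: rf_dom_def rf_val_def)
qed


section \<open>Independence of the index type\<close>

lemma eventually_tails:
  assumes "directed \<Gamma> le"
  shows "eventually P (tails \<Gamma> le) \<longleftrightarrow> (\<exists>\<alpha> \<in> \<Gamma>. \<forall>\<beta> \<in> \<Gamma>. le \<alpha> \<beta> \<longrightarrow> P \<beta>)"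
proof -
  have "\<exists>\<gamma>\<in>\<Gamma>. principal {\<beta> \<in> \<Gamma>. le \<gamma> \<beta>} \<le>
      inf (principal {\<delta> \<in> \<Gamma>. le \<alpha> \<delta>}) (principal {\<delta> \<in> \<Gamma>. le \<beta> \<delta>})"
    if "\<alpha> \<in> \<Gamma>" "\<beta> \<in> \<Gamma>" for \<alpha> \<beta>
  proof -
    obtain \<gamma> where "\<gamma> \<in> \<Gamma>" "le \<alpha> \<gamma>" "le \<beta> \<gamma>"
      using assms \<open>\<alpha> \<in> \<Gamma>\<close> \<open>\<beta> \<in> \<Gamma>\<close> unfolding directed_def by meson
    moreover have "le \<alpha> \<delta> \<and> le \<beta> \<delta>" if "\<delta> \<in> \<Gamma>" "le \<gamma> \<delta>" for \<delta>
      using assms \<open>\<alpha> \<in> \<Gamma>\<close> \<open>\<beta> \<in> \<Gamma>\<close> \<open>\<gamma> \<in> \<Gamma>\<close> \<open>le \<alpha> \<gamma>\<close> \<open>le \<beta> \<gamma>\<close> that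
      unfolding directed_def by meson
    ultimately show ?thesis by (intro bexI[of _ \<gamma>]) auto
  qed
  moreover have "\<Gamma> \<noteq> {}" using assms by (simp add: directed_def)
  ultimately show ?thesis
    unfolding tails_def by (subst eventually_INF_base) (auto simp: eventually_principal)
qed

lemma net_reindex:
  fixes \<Gamma> :: "'i set" and X :: "'i \<Rightarrow> real \<times> real"
  assumes "directed \<Gamma> le"
  obtains \<Delta> :: "net_index set" and le'
  where "directed \<Delta> le'" "fst ` \<Delta> = X ` \<Gamma>"
    "filtermap fst (tails \<Delta> le') = filtermap X (tails \<Gamma> le)"
proof -
  define T where "T \<alpha> = X ` {\<beta> \<in> \<Gamma>. le \<alpha> \<beta>}" for \<alpha>
  define \<Delta> where "\<Delta> = {(w, A). \<exists>\<alpha> \<in> \<Gamma>. A = T \<alpha> \<and> w \<in> A}"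
  define le' :: "net_index \<Rightarrow> net_index \<Rightarrow> bool" where "le' i j \<longleftrightarrow> snd j \<subseteq> snd i" for i j
  have ne: "\<Gamma> \<noteq> {}" and refl: "\<And>\<alpha>. \<alpha> \<in> \<Gamma> \<Longrightarrow> le \<alpha> \<alpha>"
    using assms by (auto simp: directed_def)
  have mono: "T \<beta> \<subseteq> T \<alpha>" if "\<alpha> \<in> \<Gamma>" "\<beta> \<in> \<Gamma>" "le \<alpha> \<beta>" for \<alpha> \<beta>
    using assms that unfolding T_def directed_def by (intro image_mono) blast
  have in\<Delta>: "(X \<alpha>, T \<alpha>) \<in> \<Delta>" if "\<alpha> \<in> \<Gamma>" for \<alpha>
    using that refl unfolding \<Delta>_def T_def by auto
  have dir: "directed \<Delta> le'"
    unfolding directed_def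
  proof (intro conjI ballI impI)
    show "\<Delta> \<noteq> {}" using ne in\<Delta> by blast
  next
    fix i j assume "i \<in> \<Delta>" "j \<in> \<Delta>"
    then obtain \<alpha> \<beta> where ab: "\<alpha> \<in> \<Gamma>" "snd i = T \<alpha>" "\<beta> \<in> \<Gamma>" "snd j = T \<beta>"
      unfolding \<Delta>_def by auto
    obtain \<gamma> where "\<gamma> \<in> \<Gamma>" "le \<alpha> \<gamma>" "le \<beta> \<gamma>"
      using assms ab unfolding directed_def by meson
    then show "\<exists>k\<in>\<Delta>. le' i k \<and> le' j k"
      using ab mono in\<Delta>[of \<gamma>] unfolding le'_def by (intro bexI[of _ "(X \<gamma>, T \<gamma>)"]) auto
  qed (auto simp: le'_def)
  have im: "fst ` \<Delta> = X ` \<Gamma>"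
  proof
    show "fst ` \<Delta> \<subseteq> X ` \<Gamma>" unfolding \<Delta>_def T_def by auto
    show "X ` \<Gamma> \<subseteq> fst ` \<Delta>" using in\<Delta> by force
  qed
  have "filtermap fst (tails \<Delta> le') = filtermap X (tails \<Gamma> le)"
  proof (rule filter_eq_iff[THEN iffD2], rule allI)
    fix P
    have "(\<exists>i \<in> \<Delta>. \<forall>j \<in> \<Delta>. le' i j \<longrightarrow> P (fst j)) \<longleftrightarrow> (\<exists>\<alpha> \<in> \<Gamma>. \<forall>w \<in> T \<alpha>. P w)"
    proof
      assume "\<exists>i \<in> \<Delta>. \<forall>j \<in> \<Delta>. le' i j \<longrightarrow> P (fst j)"
      then obtain i where i: "i \<in> \<Delta>" "\<And>j. j \<in> \<Delta> \<Longrightarrow> le' i j \<Longrightarrow> P (fst j)" by blast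
      then obtain \<alpha> where a: "\<alpha> \<in> \<Gamma>" "snd i = T \<alpha>" unfolding \<Delta>_def by auto
      have "P w" if "w \<in> T \<alpha>" for w
        using i(2)[of "(w, T \<alpha>)"] a that by (auto simp: \<Delta>_def le'_def)
      then show "\<exists>\<alpha> \<in> \<Gamma>. \<forall>w \<in> T \<alpha>. P w" using a by blast
    next
      assume "\<exists>\<alpha> \<in> \<Gamma>. \<forall>w \<in> T \<alpha>. P w"
      then obtain \<alpha> where a: "\<alpha> \<in> \<Gamma>" "\<forall>w \<in> T \<alpha>. P w" by blast
      then show "\<exists>i \<in> \<Delta>. \<forall>j \<in> \<Delta>. le' i j \<longrightarrow> P (fst j)"
        by (intro bexI[OF _ in\<Delta>[of \<alpha>]]) (auto simp: \<Delta>_def le'_def)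
    qed
    also have "\<dots> \<longleftrightarrow> (\<exists>\<alpha> \<in> \<Gamma>. \<forall>\<beta> \<in> \<Gamma>. le \<alpha> \<beta> \<longrightarrow> P (X \<beta>))"
      by (auto simp: T_def)
    finally show "eventually P (filtermap fst (tails \<Delta> le')) = eventually P (filtermap X (tails \<Gamma> le))"
      by (simp add: eventually_filtermap eventually_tails[OF dir] eventually_tails[OF assms])
  qed
  with dir im that show ?thesis by blast
qed

lemma X1_I:
  fixes \<Gamma> :: "'i set"
  assumes "is_character (bounded_rf z) \<xi>" "X1_net \<Gamma> le x y z \<xi>"
  shows "\<xi> \<in> X1 z"
proof -
  define X where "X \<gamma> = (x \<gamma>, y \<gamma>)" for \<gamma>
  have "directed \<Gamma> le" using assms(2) by (simp add: X1_net_def)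
  then obtain \<Delta> :: "net_index set" and le' where \<Delta>: "directed \<Delta> le'" "fst ` \<Delta> = X ` \<Gamma>"
    "filtermap fst (tails \<Delta> le') = filtermap X (tails \<Gamma> le)"
    by (rule net_reindex)
  have x: "x \<gamma> = fst (X \<gamma>)" and y: "y \<gamma> = snd (X \<gamma>)" for \<gamma> by (simp_all add: X_def)
  have lim: "((\<lambda>i. G (fst i)) \<longlongrightarrow> L) (tails \<Delta> le') \<longleftrightarrow> ((\<lambda>\<gamma>. G (X \<gamma>)) \<longlongrightarrow> L) (tails \<Gamma> le)"
    for G :: "real \<times> real \<Rightarrow> 'b::topological_space" and L
    using \<Delta>(3) by (metis filterlim_filtermap)
  have ball: "(\<forall>i \<in> \<Delta>. Q (fst i)) \<longleftrightarrow> (\<forall>\<gamma> \<in> \<Gamma>. Q (X \<gamma>))" for Q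
    using \<Delta>(2) by (metis (no_types, lifting) image_iff)
  have "approach \<Delta> le' (\<lambda>i. u (fst i)) (\<lambda>i. v (fst i)) u0 v0 \<longleftrightarrow>
      approach \<Gamma> le (\<lambda>\<gamma>. u (X \<gamma>)) (\<lambda>\<gamma>. v (X \<gamma>)) u0 v0" for u v u0 v0
    unfolding approach_def
      ball[of "\<lambda>w. u w > u0"] ball[of "\<lambda>w. u w < u0"]
      lim[of "\<lambda>w. (v w - v0) / (u w - u0)"]
      lim[of "\<lambda>w. (v w - v0 - _ (u w - u0)) / \<bar>u w - u0\<bar> powr _"] ..
  then have "X1_net \<Delta> le' (\<lambda>i. fst (fst i)) (\<lambda>i. snd (fst i)) z \<xi>"
    using assms(2) \<Delta>(1)
    unfolding X1_net_def determines_def x y prod.collapse lim[of "\<lambda>w. w"] lim[of "rf_val _"]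
    by simp
  then show ?thesis using assms(1) unfolding X1_def by blast
qed

end

theory Submission
  imports Defs "HOL-Library.Landau_Symbols"
begin

text \<open>
  Write \<open>f = p / q\<close> in lowest terms, bounded near \<open>z0 = (x0, y0)\<close>, and let \<open>d\<close> be the limit of \<open>f\<close>
  along a sequence of points tending to \<open>z0\<close>.  The idea is to replace the sequence by an arc
  \<open>x = x0 \<plusminus> \<tau>^s\<close>, \<open>y = y0 + \<tau>^s \<Theta>(\<tau>)\<close> with \<open>\<Theta>\<close> a polynomial, or the same with the coordinates
  exchanged, along which \<open>f\<close> still tends to \<open>d\<close> as \<open>\<tau> \<rightarrow> 0+\<close>.  Eliminating \<open>\<tau>\<close> shows \<open>y - y0\<close> to be
  a function of type I of \<open>x - x0\<close> on such an arc.  The arc moreover determines a character: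
  on it a bounded rational function becomes a bounded quotient of two real polynomials in \<open>\<tau>\<close>,
  and such a quotient has a limit.

  The arc comes from Newton's algorithm, run along the sequence.  After passing to a subsequence
  that stays in one of the two cones \<open>\<bar>y - y0\<bar> \<le> \<bar>x - x0\<bar>\<close> and \<open>\<bar>x - x0\<bar> \<le> \<bar>y - y0\<bar>\<close> and converges in
  direction, there are coordinates \<open>t > 0\<close> and \<open>u\<close>, both tending to 0 along the sequence, in which
  \<open>f = P / (t^w Q)\<close> with \<open>Q(0, u)\<close> not identically zero.  Three things can happen.
  If \<open>Q(0, 0) \<noteq> 0\<close>, boundedness of \<open>f\<close> cancels the power of \<open>t\<close>; then \<open>f\<close> extends continuously to the
  origin and the arc \<open>u = 0\<close> will do (\<open>newton_base\<close>).
  Otherwise a subsequence separates all monomials of numerator and denominator by order of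
  magnitude, or on it \<open>u\<close> is asymptotic to \<open>c t^(a/b)\<close> for some \<open>c \<noteq> 0\<close>
  (\<open>proportional_or_separated\<close>).  If the monomials are separated, an arc \<open>(t, u) = (\<tau>^b, \<tau>^a)\<close>
  puts them into the same order, so that the same monomials dominate and \<open>f\<close> has the same
  limit (\<open>newton_separated\<close>).  If \<open>u\<close> is asymptotic to \<open>c t^(a/b)\<close>, the substitution \<open>t = \<tau>^b\<close>,
  \<open>u = \<tau>^a (c + v)\<close> leads to a problem of the same kind in \<open>(\<tau>, v)\<close> (\<open>newton_substitution\<close>).

  Two numbers make the substitutions stop.  The first is a degree \<open>m\<close> in which \<open>Q(0, u)\<close> has a
  nonzero coefficient; the order of vanishing of the next \<open>Q(0, u)\<close> at \<open>u = 0\<close> is at most \<open>m\<close> and takes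
  its place.  While \<open>m\<close> stays the same, no ramification occurs, that is \<open>b = 1\<close>, and a positive
  power of \<open>t\<close> splits off from \<open>Q\<close>; so the exponent \<open>K\<close> of a lower bound \<open>\<epsilon> t^K \<le> \<bar>Q\<bar>\<close> drops.
  Such a lower bound exists to begin with because \<open>p\<close> and \<open>q\<close> are coprime: an identity
  \<open>a p + b q = r(x) \<noteq> 0\<close> and \<open>\<bar>p\<bar> \<le> M \<bar>q\<bar>\<close> give \<open>\<bar>r(x)\<bar> \<le> C \<bar>q(x, y)\<bar>\<close> near \<open>z0\<close>
  (\<open>denominator_lower_bound\<close>).  The convergence of Puiseux series is not involved:
  the lower bound allows the expansion to be cut off after finitely many terms.
\<close>

section \<open>Substitution into polynomials in two variables\<close>

lemma ev_pCons: "ev (pCons c p) (x, y) = poly c x + y * ev p (x, y)"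
  by (simp add: ev_def)

lemma ev_const_poly: "ev [:c:] (x, y) = poly c x"
  by (simp add: ev_def)

lemma ev_diff: "ev (p - q) z = ev p z - ev q z"
  by (simp add: ev_def)

lemma isCont_ev: "isCont (ev p) z"
  using continuous_ev[of p] continuous_on_eq_continuous_at[OF open_UNIV] by blast

text \<open>
  Coordinate changes are used only through the values of the resulting polynomial, so its mere
  existence is all that is recorded.
\<close>

lemma ex_poly_xy_compose: "\<exists>P. \<forall>w. ev P w = ev p (ev X w, ev Y w)"
proof (induction p)
  case 0
  show ?case by (intro exI[of _ 0]) simp
next
  case (pCons c p)
  have "\<exists>C. \<forall>w. ev C w = poly c (ev X w)" for c :: "real poly"
  proof (induction c)
    case 0
    show ?case by (intro exI[of _ 0]) simp
  next
    case (pCons a c)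
    then obtain C where "\<forall>w. ev C w = poly c (ev X w)" by blast
    then show ?case by (intro exI[of _ "[:[:a:]:] + X * C"]) (simp del: One_nat_def)
  qed
  then obtain C where "\<forall>w. ev C w = poly c (ev X w)" by blast
  moreover obtain P where "\<forall>w. ev P w = ev p (ev X w, ev Y w)" using pCons by blast
  ultimately show ?case by (intro exI[of _ "C + Y * P"]) (simp add: ev_pCons)
qed

lemma ex_poly_compose: "\<exists>A :: real poly. \<forall>\<tau>. poly A \<tau> = ev p (poly X \<tau>, poly Y \<tau>)"
proof (induction p)
  case 0
  show ?case by (intro exI[of _ 0]) simp
next
  case (pCons c p)
  then obtain A where "\<forall>\<tau>. poly A \<tau> = ev p (poly X \<tau>, poly Y \<tau>)" by blast
  then show ?case by (intro exI[of _ "pcompose c X + Y * A"]) (simp add: ev_pCons poly_pcompose)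
qed

lemma ev_eq_iff: "(\<forall>z. ev p z = ev q z) \<longleftrightarrow> p = q"
proof
  assume eq: "\<forall>z. ev p z = ev q z"
  show "p = q"
  proof (rule ccontr)
    assume "p \<noteq> q"
    then have "\<forall>\<^sub>F x in at 0. \<forall>\<^sub>F y in at 0. ev (p - q) (x, y) \<noteq> 0"
      by (intro eventually_ev_nonzero) simp
    then have "\<forall>\<^sub>F x in at (0::real). \<forall>\<^sub>F y in at (0::real). False"
      using eq by (simp add: ev_diff)
    then show False by (simp add: eventually_False)
  qed
qed simp

text \<open>
  The two variables play different roles in the type of iterated polynomials.  The exchanged
  polynomial is characterised by its values, which determine it by \<open>ev_eq_iff\<close>; multiplicativity and
  involutivity then need no computation with coefficients.
\<close>

definition swap_xy :: "poly_xy \<Rightarrow> poly_xy" where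
  "swap_xy p = (SOME P. \<forall>x y. ev P (x, y) = ev p (y, x))"

lemma ev_swap_xy: "ev (swap_xy p) (x, y) = ev p (y, x)"
proof -
  have "ev [:[:0, 1:]:] w = fst w" "ev [:0, 1:] w = snd w" for w
    by (simp_all add: ev_def)
  then have "\<exists>P. \<forall>x y. ev P (x, y) = ev p (y, x)"
    using ex_poly_xy_compose[of p "[:0, 1:]" "[:[:0, 1:]:]"] by auto
  from someI_ex[OF this] show ?thesis by (simp add: swap_xy_def)
qed

lemma swap_xy_simps [simp]:
  "swap_xy (swap_xy p) = p" "swap_xy (p * q) = swap_xy p * swap_xy q" "swap_xy 1 = 1"
  by (rule ev_eq_iff[THEN iffD1], simp add: ev_swap_xy)+

lemma ev_swap_xy': "ev (swap_xy p) z = ev p (prod.swap z)"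
  by (cases z) (simp add: ev_swap_xy)

lemma swap_xy_eq_0_iff: "swap_xy p = 0 \<longleftrightarrow> p = 0"
proof
  have "swap_xy 0 = 0" by (rule ev_eq_iff[THEN iffD1]) (simp add: ev_swap_xy')
  then show "swap_xy p = 0" if "p = 0" using that by simp
  show "p = 0" if "swap_xy p = 0" using that \<open>swap_xy 0 = 0\<close> swap_xy_simps(1)[of p] by simp
qed

lemma eventually_nhds_swap:
  "eventually P (nhds (a, b)) \<Longrightarrow> \<forall>\<^sub>F z in nhds (b :: real, a :: real). P (prod.swap z)"
proof (erule eventually_compose_filterlim)
  have "((\<lambda>z :: real \<times> real. (snd z, fst z)) \<longlongrightarrow> (snd (b, a), fst (b, a))) (nhds (b, a))"
    by (intro tendsto_intros filterlim_ident)
  then show "filterlim prod.swap (nhds (a, b)) (nhds (b, a))"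
    by (simp add: prod.swap_def[abs_def])
qed

lemma coprime_swap_xy: "coprime p q \<Longrightarrow> coprime (swap_xy p) (swap_xy q)"
proof (rule coprimeI)
  fix d assume "coprime p q" and d: "d dvd swap_xy p" "d dvd swap_xy q"
  have "swap_xy d dvd swap_xy (swap_xy p)" "swap_xy d dvd swap_xy (swap_xy q)"
    using d by (metis dvd_def swap_xy_simps(2))+
  then have "swap_xy d dvd 1" using \<open>coprime p q\<close> by (auto intro: coprime_common_divisor)
  then have "swap_xy (swap_xy d) dvd swap_xy 1" by (metis dvd_def swap_xy_simps(2))
  then show "d dvd 1" by simp
qed

section \<open>Elimination of y\<close>

text \<open>
  In the ideal generated by \<open>p\<close> and \<open>q\<close>, pseudo-division by a nonzero element \<open>g\<close> of least degree in \<open>y\<close>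
  leaves no remainder.  By Gauss' lemma the primitive part of \<open>g\<close> therefore divides \<open>p\<close> and \<open>q\<close>, hence
  is a unit, and \<open>g\<close> is free of \<open>y\<close>.
\<close>

lemma coprime_imp_elimination:
  fixes p q :: poly_xy
  assumes "coprime p q" "q \<noteq> 0"
  obtains a b r where "a * p + b * q = [:r:]" "r \<noteq> 0"
proof -
  define I where "I = {h. \<exists>a b. h = a * p + b * q}"
  define g where "g = arg_min degree (\<lambda>h. h \<in> I \<and> h \<noteq> 0)"
  have qI: "q \<in> I" and pI: "p \<in> I"
    unfolding I_def by (metis (mono_tags, lifting) add_0 add.right_neutral mem_Collect_eq mult_1 mult_zero_left)+
  have g: "g \<in> I" "g \<noteq> 0" and g_min: "\<And>h. h \<in> I \<Longrightarrow> h \<noteq> 0 \<Longrightarrow> degree g \<le> degree h"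
    using arg_min_natI[of "\<lambda>h. h \<in> I \<and> h \<noteq> 0" q degree] arg_min_nat_le[of "\<lambda>h. h \<in> I \<and> h \<noteq> 0" _ degree]
      qI assms(2) unfolding g_def by auto
  obtain a b where ab: "g = a * p + b * q" using g(1) unfolding I_def by blast
  obtain g0 where g0: "g = smult (content g) g0" "content g0 = 1" by (rule content_decompose)
  have dvd: "g0 dvd h" if h: "h \<in> I" for h
  proof -
    obtain s r where sr: "pseudo_divmod h g = (s, r)" by (cases "pseudo_divmod h g")
    define c where "c = coeff g (degree g) ^ (Suc (degree h) - degree g)"
    have c: "c \<noteq> 0" using g(2) by (simp add: c_def)
    have eq: "smult c h = g * s + r" and r: "r = 0 \<or> degree r < degree g"
      using pseudo_divmod[OF g(2) sr] by (simp_all add: c_def)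
    obtain a' b' where ab': "h = a' * p + b' * q" using h unfolding I_def by blast
    have "r = smult c h - g * s" using eq by simp
    also have "\<dots> = (smult c a' - a * s) * p + (smult c b' - b * s) * q"
      unfolding ab ab' by (simp add: algebra_simps smult_add_right)
    finally have "r \<in> I" unfolding I_def by blast
    then have "r = 0" using r g_min[of r] by fastforce
    then have "smult c h = g * s" using eq by simp
    then have "fract_poly (smult c h) = fract_poly (smult (content g) (g0 * s))"
      using g0(1) by (metis mult_smult_left)
    then have "smult (to_fract c) (fract_poly h) = fract_poly g0 * smult (to_fract (content g)) (fract_poly s)"
      by (simp only: fract_poly_smult fract_poly_mult mult_smult_right)
    then have "fract_poly g0 dvd smult (to_fract c) (fract_poly h)"
      by (metis dvd_triv_left)
    then have "fract_poly g0 dvd fract_poly h"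
      using c by (subst (asm) dvd_smult_iff) auto
    then show ?thesis using g0(2) by (rule fract_poly_dvdD)
  qed
  have "is_unit g0" using coprime_common_divisor[OF assms(1) dvd[OF pI] dvd[OF qI]] .
  then have "degree g0 = 0" by (auto simp: is_unit_poly_iff)
  then have "degree g = 0" using g0(1) by (metis degree_smult_le le_zero_eq)
  then obtain r where "g = [:r:]" by (rule degree_eq_zeroE)
  then show thesis using that[of a b r] ab g(2) by auto
qed

lemma poly_lower_bound:
  fixes r :: "real poly"
  assumes "r \<noteq> 0"
  obtains c K where "c > 0" "\<forall>\<^sub>F x in nhds a. c * \<bar>x - a\<bar> ^ K \<le> \<bar>poly r x\<bar>"
proof -
  obtain s where s: "r = [:- a, 1:] ^ order a r * s" "\<not> [:- a, 1:] dvd s"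
    using order_decomp[OF assms] by blast
  have s0: "\<bar>poly s a\<bar> > 0" using s(2) by (simp add: poly_eq_0_iff_dvd)
  have "isCont (\<lambda>x. \<bar>poly s x\<bar>) a" by (intro continuous_intros)
  then have "((\<lambda>x. \<bar>poly s x\<bar>) \<longlongrightarrow> \<bar>poly s a\<bar>) (nhds a)" by (simp add: continuous_within tendsto_nhds_iff)
  then have "\<forall>\<^sub>F x in nhds a. \<bar>poly s a\<bar> / 2 < \<bar>poly s x\<bar>"
    using s0 by (intro order_tendstoD) auto
  then have "\<forall>\<^sub>F x in nhds a. \<bar>poly s a\<bar> / 2 * \<bar>x - a\<bar> ^ order a r \<le> \<bar>poly r x\<bar>"
  proof (rule eventually_mono)
    fix x assume x: "\<bar>poly s a\<bar> / 2 < \<bar>poly s x\<bar>"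
    have "poly r x = (x - a) ^ order a r * poly s x" 
      by (subst s(1)) (simp add: poly_power)
    then have "\<bar>poly r x\<bar> = \<bar>poly s x\<bar> * \<bar>x - a\<bar> ^ order a r"
      by (simp add: abs_mult power_abs)
    then show "\<bar>poly s a\<bar> / 2 * \<bar>x - a\<bar> ^ order a r \<le> \<bar>poly r x\<bar>"
      using mult_right_mono[of "\<bar>poly s a\<bar> / 2" "\<bar>poly s x\<bar>" "\<bar>x - a\<bar> ^ order a r"] x by simp
  qed
  then show thesis using that[of "\<bar>poly s a\<bar> / 2" "order a r"] s0 by simp
qed

lemma eventually_abs_ev_le:
  obtains C where "C > 0" "\<forall>\<^sub>F z in nhds z0. \<bar>ev a z\<bar> \<le> C"
proof -
  have "isCont (\<lambda>z. \<bar>ev a z\<bar>) z0" using isCont_ev by (intro continuous_intros)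
  then have "((\<lambda>z. \<bar>ev a z\<bar>) \<longlongrightarrow> \<bar>ev a z0\<bar>) (nhds z0)" by (simp add: continuous_within tendsto_nhds_iff)
  then have "\<forall>\<^sub>F z in nhds z0. \<bar>ev a z\<bar> < \<bar>ev a z0\<bar> + 1" by (intro order_tendstoD) auto
  then have "\<forall>\<^sub>F z in nhds z0. \<bar>ev a z\<bar> \<le> \<bar>ev a z0\<bar> + 1" by (rule eventually_mono) simp
  then show thesis using that[of "\<bar>ev a z0\<bar> + 1"] by simp
qed

text \<open>
  A Lojasiewicz inequality for \<open>q\<close>.  As \<open>\<bar>p\<bar> \<le> M \<bar>q\<bar>\<close>, a combination \<open>r = a p + b q\<close> satisfies \<open>\<bar>r\<bar> \<le> C \<bar>q\<bar>\<close>,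
  and coprimality provides such an \<open>r\<close> that depends on \<open>x\<close> alone.
\<close>

lemma denominator_lower_bound:
  assumes "coprime p q" "q \<noteq> 0" and bnd: "\<forall>\<^sub>F z in nhds (x0, y0). \<bar>ev p z\<bar> \<le> M * \<bar>ev q z\<bar>"
  obtains c K where "c > 0" "\<forall>\<^sub>F z in nhds (x0, y0). c * \<bar>fst z - x0\<bar> ^ K \<le> \<bar>ev q z\<bar>"
proof -
  obtain a b r where abr: "a * p + b * q = [:r:]" "r \<noteq> 0"
    using coprime_imp_elimination[OF assms(1,2)] .
  obtain c K where c: "c > 0" "\<forall>\<^sub>F x in nhds x0. c * \<bar>x - x0\<bar> ^ K \<le> \<bar>poly r x\<bar>"
    using poly_lower_bound[OF abr(2)] .
  obtain A where A: "A > 0" "\<forall>\<^sub>F z in nhds (x0, y0). \<bar>ev a z\<bar> \<le> A" using eventually_abs_ev_le .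
  obtain B where B: "B > 0" "\<forall>\<^sub>F z in nhds (x0, y0). \<bar>ev b z\<bar> \<le> B" using eventually_abs_ev_le .
  define C where "C = A * \<bar>M\<bar> + B"
  have C: "C > 0" using A(1) B(1) by (simp add: C_def add_nonneg_pos)
  have "filterlim fst (nhds x0) (nhds (x0, y0))"
    using filterlim_fst by (simp add: nhds_prod)
  from eventually_compose_filterlim[OF c(2) this]
  have "\<forall>\<^sub>F z in nhds (x0, y0). c * \<bar>fst z - x0\<bar> ^ K \<le> \<bar>poly r (fst z)\<bar>" .
  then have "\<forall>\<^sub>F z in nhds (x0, y0). c / C * \<bar>fst z - x0\<bar> ^ K \<le> \<bar>ev q z\<bar>"
    using A(2) B(2) bnd
  proof eventually_elim
    case (elim z)
    have "poly r (fst z) = ev a z * ev p z + ev b z * ev q z"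
      using arg_cong[OF abr(1), of "\<lambda>p. ev p z"] by (cases z) (simp add: ev_const_poly)
    then have "\<bar>poly r (fst z)\<bar> \<le> \<bar>ev a z\<bar> * \<bar>ev p z\<bar> + \<bar>ev b z\<bar> * \<bar>ev q z\<bar>"
      by (metis abs_mult abs_triangle_ineq)
    also have "\<dots> \<le> A * (\<bar>M\<bar> * \<bar>ev q z\<bar>) + B * \<bar>ev q z\<bar>"
    proof (intro add_mono mult_mono)
      show "\<bar>ev p z\<bar> \<le> \<bar>M\<bar> * \<bar>ev q z\<bar>"
        using elim(4) by (meson abs_ge_self abs_ge_zero mult_right_mono order_trans)
    qed (use elim A(1) B(1) in auto)
    also have "\<dots> = C * \<bar>ev q z\<bar>" by (simp add: C_def algebra_simps)
    finally show ?case using elim(1) C by (simp add: field_simps)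
  qed
  then show thesis using that[of "c / C" K] c(1) C by simp
qed

section \<open>Newton polygons\<close>

text \<open>
  The pair \<open>(i, j)\<close> stands for the monomial \<open>t^i u^j\<close>; the outer variable is the second one.
\<close>

definition supp :: "poly_xy \<Rightarrow> (nat \<times> nat) set" where
  "supp p = {(i, j). coeff (coeff p j) i \<noteq> 0}"

lemma finite_supp: "finite (supp p)"
proof (rule finite_subset)
  show "supp p \<subseteq> (\<Union>j\<le>degree p. {..degree (coeff p j)} \<times> {j})"
    by (auto simp: supp_def intro: le_degree) (metis coeff_0 le_degree)+
qed auto

lemma supp_nonempty: "p \<noteq> 0 \<Longrightarrow> supp p \<noteq> {}"
  by (auto simp: supp_def poly_eq_iff)

lemma ev_sum: "ev (sum f A) z = (\<Sum>a\<in>A. ev (f a) z)"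
  by (induction A rule: infinite_finite_induct) auto

lemma ev_monom: "ev (monom (monom a i) j) (t, u) = a * (t ^ i * u ^ j)"
  by (simp add: ev_def poly_monom poly_const_pow)

lemma poly_xy_eq_sum_monom: "p = (\<Sum>(i, j)\<in>supp p. monom (monom (coeff (coeff p j) i) i) j)"
proof (rule poly_eqI, rule poly_eqI)
  fix l k
  have "coeff (coeff (\<Sum>(i, j)\<in>supp p. monom (monom (coeff (coeff p j) i) i) j) l) k
      = (\<Sum>ij\<in>supp p. if ij = (k, l) then coeff (coeff p l) k else 0)"
    by (subst coeff_sum, subst coeff_sum) (auto intro!: sum.cong split: prod.splits)
  also have "\<dots> = coeff (coeff p l) k"
    using finite_supp[of p] by (simp add: supp_def)
  finally show "coeff (coeff p l) k = coeff (coeff (\<Sum>(i, j)\<in>supp p. monom (monom (coeff (coeff p j) i) i) j) l) k" ..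
qed

lemma ev_eq_sum: "ev p (t, u) = (\<Sum>(i, j)\<in>supp p. coeff (coeff p j) i * (t ^ i * u ^ j))"
  by (subst poly_xy_eq_sum_monom) (auto simp: ev_sum ev_monom intro!: sum.cong)

definition slice0 :: "poly_xy \<Rightarrow> real poly" where
  "slice0 p = map_poly (\<lambda>c. poly c 0) p"

lemma poly_slice0: "poly (slice0 p) u = ev p (0, u)"
  by (simp add: ev_slice slice0_def)

lemma coeff_slice0: "coeff (slice0 p) j = coeff (coeff p j) 0"
  by (simp add: slice0_def coeff_map_poly poly_0_coeff_0)

text \<open>
  Give \<open>t\<close> the weight \<open>b\<close> and \<open>u\<close> the weight \<open>a\<close>.  The least weight \<open>W\<close> in the support of \<open>p\<close> is the exact
  power of \<open>\<tau>\<close> that splits off after \<open>t = \<tau>^b\<close>, \<open>u = \<tau>^a v\<close>, and what is left at \<open>\<tau> = 0\<close> is the polynomial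
  of the edge of weight \<open>W\<close> of the Newton polygon.  With \<open>b = 1\<close> and \<open>a = 0\<close> this simply cancels the
  largest power of \<open>t\<close>.
\<close>

lemma weighted_initial_form:
  assumes "p \<noteq> 0" "b > 0"
  obtains W G where
    "\<And>\<tau> v. ev p (\<tau> ^ b, \<tau> ^ a * v) = \<tau> ^ W * ev G (\<tau>, v)"
    "slice0 G \<noteq> 0"
    "\<And>i j. (i, j) \<in> supp p \<Longrightarrow> W \<le> b * i + a * j"
    "\<And>j. coeff (slice0 G) j \<noteq> 0 \<Longrightarrow> \<exists>i. (i, j) \<in> supp p \<and> b * i + a * j = W"
proof -
  define \<omega> where "\<omega> = (\<lambda>(i, j). b * i + a * j)"
  define W where "W = Min (\<omega> ` supp p)"
  define G where "G = (\<Sum>(i, j)\<in>supp p. monom (monom (coeff (coeff p j) i) (\<omega> (i, j) - W)) j)"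
  have W_le: "W \<le> \<omega> ij" if "ij \<in> supp p" for ij
    unfolding W_def using finite_supp that by (intro Min_le) auto
  have "W \<in> \<omega> ` supp p"
    unfolding W_def using finite_supp supp_nonempty[OF assms(1)] by (intro Min_in) auto
  then obtain i0 j0 where ij0: "(i0, j0) \<in> supp p" "\<omega> (i0, j0) = W" by auto
  have W_iff: "\<omega> ij \<le> W \<longleftrightarrow> \<omega> ij = W" if "ij \<in> supp p" for ij
    using W_le[OF that] by auto
  have cG: "coeff (slice0 G) j = (\<Sum>(i, l)\<in>supp p. if l = j \<and> \<omega> (i, l) = W then coeff (coeff p l) i else 0)" for j
    unfolding coeff_slice0 G_def
    by (subst coeff_sum, subst coeff_sum) (auto simp: W_iff intro!: sum.cong split: prod.splits)
  have "ev p (\<tau> ^ b, \<tau> ^ a * v) = \<tau> ^ W * ev G (\<tau>, v)" for \<tau> v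
  proof -
    have "ev p (\<tau> ^ b, \<tau> ^ a * v) = (\<Sum>(i, j)\<in>supp p. \<tau> ^ W * (coeff (coeff p j) i * (\<tau> ^ (\<omega> (i, j) - W) * v ^ j)))"
      unfolding ev_eq_sum[of p]
    proof (rule sum.cong[OF refl], clarify)
      fix i j assume "(i, j) \<in> supp p"
      then have "\<omega> (i, j) = W + (\<omega> (i, j) - W)" using W_le by simp
      then have "\<tau> ^ (b * i) * \<tau> ^ (a * j) = \<tau> ^ W * \<tau> ^ (\<omega> (i, j) - W)"
        by (metis \<omega>_def case_prod_conv power_add)
      then show "coeff (coeff p j) i * ((\<tau> ^ b) ^ i * (\<tau> ^ a * v) ^ j)
        = \<tau> ^ W * (coeff (coeff p j) i * (\<tau> ^ (\<omega> (i, j) - W) * v ^ j))"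
        by (simp add: power_mult_distrib power_mult[symmetric] mult_ac)
    qed
    also have "\<dots> = \<tau> ^ W * ev G (\<tau>, v)"
      by (simp add: G_def ev_sum sum_distrib_left case_prod_unfold ev_monom)
    finally show ?thesis .
  qed
  moreover have "slice0 G \<noteq> 0"
  proof -
    have "coeff (slice0 G) j0 = (\<Sum>ij\<in>supp p. if ij = (i0, j0) then coeff (coeff p j0) i0 else 0)"
      unfolding cG using ij0 assms(2) by (intro sum.cong) (auto simp: \<omega>_def split: if_splits)
    also have "\<dots> = coeff (coeff p j0) i0" using finite_supp ij0(1) by simp
    also have "\<dots> \<noteq> 0" using ij0(1) by (simp add: supp_def)
    finally show ?thesis by auto
  qed
  moreover have "\<exists>i. (i, j) \<in> supp p \<and> b * i + a * j = W" if j: "coeff (slice0 G) j \<noteq> 0" for j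
  proof (rule ccontr)
    assume "\<nexists>i. (i, j) \<in> supp p \<and> b * i + a * j = W"
    then have "coeff (slice0 G) j = 0"
      unfolding cG by (intro sum.neutral) (auto simp: \<omega>_def split: if_splits)
    then show False using j by simp
  qed
  ultimately show thesis using that[of W G] W_le by (auto simp: \<omega>_def split: if_splits)
qed

section \<open>Limits at the corner\<close>

text \<open>
  Points \<open>(t, u)\<close> tending to the origin with \<open>t > 0\<close>.  All coordinate changes below map this filter to
  itself, which carries bounds valid near the origin from one chart to the next.
\<close>

definition corner :: "(real \<times> real) filter" where
  "corner = at_right 0 \<times>\<^sub>F nhds 0"

lemma corner_iff:
  "filterlim g corner F \<longleftrightarrow> filterlim (\<lambda>x. fst (g x)) (at_right 0) F \<and> ((\<lambda>x. snd (g x)) \<longlongrightarrow> 0) F"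
proof
  assume "filterlim g corner F"
  then show "filterlim (\<lambda>x. fst (g x)) (at_right 0) F \<and> ((\<lambda>x. snd (g x)) \<longlongrightarrow> 0) F"
    unfolding corner_def
    by (auto intro: filterlim_compose[OF filterlim_fst] filterlim_compose[OF filterlim_snd])
next
  assume "filterlim (\<lambda>x. fst (g x)) (at_right 0) F \<and> ((\<lambda>x. snd (g x)) \<longlongrightarrow> 0) F"
  then have "filterlim (\<lambda>x. (fst (g x), snd (g x))) corner F"
    unfolding corner_def by (intro filterlim_Pair) auto
  then show "filterlim g corner F" by simp
qed

lemma corner_le_nhds: "corner \<le> nhds (0, 0)"
  unfolding corner_def nhds_prod by (intro prod_filter_mono) (auto simp: at_within_le_nhds)

lemma tendsto_ev_corner: "(ev p \<longlongrightarrow> ev p (0, 0)) corner"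
proof (rule tendsto_mono[OF corner_le_nhds])
  show "(ev p \<longlongrightarrow> ev p (0, 0)) (nhds (0, 0))"
    using isCont_ev[of "(0, 0)" p] by (simp add: continuous_within tendsto_nhds_iff)
qed

lemma eventually_fst_corner: "eventually P (at_right 0) \<Longrightarrow> \<forall>\<^sub>F z in corner. P (fst z)"
  unfolding corner_def by (rule eventually_compose_filterlim[OF _ filterlim_fst])

lemma eventually_fst_corner_pos: "\<forall>\<^sub>F z in corner. fst z > 0"
  by (rule eventually_fst_corner) (simp add: eventually_at_right_less)

lemma corner_neq_bot: "corner \<noteq> bot"
  by (simp add: corner_def prod_filter_eq_bot)

text \<open>
  Divide \<open>P\<close> by the largest possible power \<open>t^W\<close>, leaving \<open>G\<close>.  If \<open>W\<close> were smaller than \<open>w\<close>, the bound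
  would force \<open>G(t, u) \<rightarrow> 0\<close> as \<open>t \<rightarrow> 0\<close> for all small \<open>u\<close>, so \<open>G(0, u)\<close> would vanish identically.  Hence
  \<open>t^w\<close> cancels and the quotient is continuous at the origin.
\<close>

lemma bounded_quotient_tendsto_corner:
  assumes unit: "ev Q (0, 0) \<noteq> 0"
    and bnd: "\<forall>\<^sub>F z in corner. \<bar>ev P z\<bar> \<le> M * \<bar>fst z ^ w * ev Q z\<bar>"
  shows "\<exists>L. ((\<lambda>z. ev P z / (fst z ^ w * ev Q z)) \<longlongrightarrow> L) corner"
proof (cases "P = 0")
  case True
  then show ?thesis by (intro exI[of _ 0]) simp
next
  case False
  obtain W G where "\<And>\<tau> v. ev P (\<tau> ^ 1, \<tau> ^ 0 * v) = \<tau> ^ W * ev G (\<tau>, v)" "slice0 G \<noteq> 0"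
    using weighted_initial_form[OF False zero_less_one] by metis
  then have PG: "ev P (t, u) = t ^ W * ev G (t, u)" and G: "slice0 G \<noteq> 0" for t u by simp_all
  have "w \<le> W"
  proof (rule ccontr)
    assume "\<not> w \<le> W"
    then have w: "t ^ w = t ^ W * t ^ (w - W)" for t :: real by (simp flip: power_add)
    have "\<forall>\<^sub>F z in corner. \<bar>ev G z\<bar> \<le> M * \<bar>fst z ^ (w - W) * ev Q z\<bar>"
      using bnd eventually_fst_corner_pos
    proof eventually_elim
      case (elim z)
      have "fst z ^ W * \<bar>ev G z\<bar> = \<bar>ev P z\<bar>"
        using elim(2) PG[of "fst z" "snd z"] by (simp add: abs_mult)
      also have "\<dots> \<le> M * \<bar>fst z ^ w * ev Q z\<bar>" using elim(1) .
      also have "\<dots> = fst z ^ W * (M * \<bar>fst z ^ (w - W) * ev Q z\<bar>)"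
        using elim(2) w by (simp add: abs_mult mult_ac)
      finally show ?case using elim(2) by simp
    qed
    then obtain A B where A: "eventually A (at_right (0::real))" and B: "eventually B (nhds (0::real))"
      and AB: "\<And>t u. A t \<Longrightarrow> B u \<Longrightarrow> \<bar>ev G (t, u)\<bar> \<le> M * \<bar>t ^ (w - W) * ev Q (t, u)\<bar>"
      unfolding corner_def eventually_prod_filter by auto
    have lim: "((\<lambda>t. ev p (t, u)) \<longlongrightarrow> ev p (0, u)) (at_right 0)" for p u
    proof -
      have "((\<lambda>t. (t, u)) \<longlongrightarrow> (0, u)) (at_right 0)" by (intro tendsto_intros)
      then show ?thesis using isCont_tendsto_compose[OF isCont_ev] by blast
    qed
    have "\<forall>\<^sub>F u in nhds 0. poly (slice0 G) u = 0"
      using B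
    proof (rule eventually_mono)
      fix u assume "B u"
      with A have "\<forall>\<^sub>F t in at_right 0. \<bar>ev G (t, u)\<bar> \<le> M * \<bar>t ^ (w - W) * ev Q (t, u)\<bar>"
        using AB by (auto elim: eventually_mono)
      moreover have "((\<lambda>t. \<bar>ev G (t, u)\<bar>) \<longlongrightarrow> \<bar>ev G (0, u)\<bar>) (at_right 0)"
        by (intro tendsto_intros lim)
      moreover have "((\<lambda>t. M * \<bar>t ^ (w - W) * ev Q (t, u)\<bar>) \<longlongrightarrow> M * \<bar>0 ^ (w - W) * ev Q (0, u)\<bar>) (at_right 0)"
        by (intro tendsto_intros lim)
      ultimately have "\<bar>ev G (0, u)\<bar> \<le> M * \<bar>0 ^ (w - W) * ev Q (0, u)\<bar>"
        by (intro tendsto_le[OF trivial_limit_at_right_real])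
      then show "poly (slice0 G) u = 0" using \<open>\<not> w \<le> W\<close> by (simp add: poly_slice0 zero_power)
    qed
    then have "\<forall>\<^sub>F u in at 0. poly (slice0 G) u = 0" by (simp add: eventually_nhds_conv_at)
    with eventually_poly_nonzero[OF G, of 0] have "\<forall>\<^sub>F u in at (0::real). False"
      by eventually_elim simp
    then show False by simp
  qed
  have "((\<lambda>z. fst z ^ (W - w) * ev G z / ev Q z) \<longlongrightarrow> 0 ^ (W - w) * ev G (0, 0) / ev Q (0, 0)) corner"
  proof (intro tendsto_intros tendsto_ev_corner unit)
    show "(fst \<longlongrightarrow> 0) corner"
      using tendsto_fst[OF filterlim_mono[OF filterlim_ident order_refl corner_le_nhds]] by simp
  qed
  moreover have "\<forall>\<^sub>F z in corner. fst z ^ (W - w) * ev G z / ev Q z = ev P z / (fst z ^ w * ev Q z)"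
    using eventually_fst_corner_pos
  proof (rule eventually_mono)
    fix z :: "real \<times> real" assume "0 < fst z"
    moreover have "fst z ^ W = fst z ^ w * fst z ^ (W - w)"
      using \<open>w \<le> W\<close> by (simp flip: power_add)
    ultimately show "fst z ^ (W - w) * ev G z / ev Q z = ev P z / (fst z ^ w * ev Q z)"
      using PG[of "fst z" "snd z"] by (simp add: mult_ac)
  qed
  ultimately show ?thesis by (blast intro: Lim_transform_eventually)
qed

section \<open>Separation of monomials\<close>

lemma ereal_subsequences:
  fixes X :: "'a \<Rightarrow> nat \<Rightarrow> ereal"
  assumes "finite R"
  obtains \<sigma> where "strict_mono \<sigma>" "\<And>r. r \<in> R \<Longrightarrow> \<exists>L. (\<lambda>n. X r (\<sigma> n)) \<longlonglongrightarrow> L"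
proof -
  have "\<exists>\<sigma>. strict_mono \<sigma> \<and> (\<forall>r\<in>R. \<exists>L. (\<lambda>n. X r (\<sigma> n)) \<longlonglongrightarrow> L)"
    using assms
  proof induction
    case empty
    show ?case by (intro exI[of _ id]) (simp add: strict_mono_def)
  next
    case (insert r R)
    then obtain \<sigma> where \<sigma>: "strict_mono \<sigma>" "\<forall>r\<in>R. \<exists>L. (\<lambda>n. X r (\<sigma> n)) \<longlonglongrightarrow> L" by blast
    obtain L \<rho> where \<rho>: "strict_mono (\<rho> :: nat \<Rightarrow> nat)" "((\<lambda>n. X r (\<sigma> n)) \<circ> \<rho>) \<longlonglongrightarrow> L"
      using compact_complete_linorder[of "\<lambda>n. X r (\<sigma> n)"] by blast
    show ?case
    proof (intro exI conjI ballI)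
      show "strict_mono (\<lambda>n. \<sigma> (\<rho> n))" using strict_mono_o[OF \<sigma>(1) \<rho>(1)] by (simp only: o_def)
      fix r' assume "r' \<in> insert r R"
      then consider "r' = r" | "r' \<in> R" by (elim insertE)
      then show "(\<lambda>n. X r' (\<sigma> (\<rho> n))) \<longlonglongrightarrow> lim (\<lambda>n. X r' (\<sigma> (\<rho> n)))"
      proof cases
        case 1
        then show ?thesis using \<rho>(2) limI[OF \<rho>(2)] by (simp only: o_def)
      next
        case 2
        from bspec[OF \<sigma>(2) 2] obtain L' where "(\<lambda>n. X r' (\<sigma> n)) \<longlonglongrightarrow> L'" by (elim exE)
        from LIMSEQ_subseq_LIMSEQ[OF this \<rho>(1)] have "(\<lambda>n. X r' (\<sigma> (\<rho> n))) \<longlonglongrightarrow> L'"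
          by (simp only: o_def)
        with limI[OF this] show ?thesis by (simp only:)
      qed
    qed
  qed
  then show thesis using that by (elim exE conjE) (rule that, auto)
qed

lemma smallo_mult_self:
  fixes h g :: "'a \<Rightarrow> real"
  assumes "(h \<longlongrightarrow> 0) F" "\<forall>\<^sub>F x in F. f x = h x * g x"
  shows "f \<in> o[F](g)"
proof -
  have "h \<in> o[F](\<lambda>_. 1)" using assms(1) by (intro smalloI_tendsto) auto
  from landau_o.small_big_mult[OF this landau_o.big_refl[of g]]
  have "(\<lambda>x. h x * g x) \<in> o[F](g)" by simp
  then show ?thesis using landau_o.small.in_cong[OF assms(2)] by blast
qed

text \<open>
  The exponents \<open>r\<close> for which \<open>u\<close> is negligible against \<open>t^r\<close> form an initial segment of the line.
\<close>

lemma tendsto_powr_scale_down: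
  fixes t u :: "nat \<Rightarrow> real"
  assumes t: "filterlim t (at_right 0) sequentially"
    and lim: "(\<lambda>n. u n / t n powr r) \<longlonglongrightarrow> 0" and "r' \<le> r"
  shows "(\<lambda>n. u n / t n powr r') \<longlonglongrightarrow> 0"
proof (cases "r' = r")
  case False
  have t0: "t \<longlonglongrightarrow> 0" and pos: "\<forall>\<^sub>F n in sequentially. t n > 0"
    using t by (auto simp: filterlim_at elim: eventually_mono)
  have "(\<lambda>n. t n powr (r - r')) \<longlonglongrightarrow> 0 powr (r - r')"
    using assms(3) False pos by (intro tendsto_powr2 t0 tendsto_const) (auto elim: eventually_mono)
  from tendsto_mult[OF lim this] have "(\<lambda>n. u n / t n powr r * t n powr (r - r')) \<longlonglongrightarrow> 0" by simp
  moreover have "\<forall>\<^sub>F n in sequentially. u n / t n powr r * t n powr (r - r') = u n / t n powr r'"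
    using pos by eventually_elim (simp add: powr_diff field_simps)
  ultimately show ?thesis by (rule Lim_transform_eventually)
qed (use lim in simp)

text \<open>
  The positivity of the elements of \<open>B\<close> leaves room for a cut above 0, also when \<open>A\<close> is empty.
\<close>

lemma rational_cut:
  fixes A B :: "real set"
  assumes "finite A" "finite B" "\<And>x y. x \<in> A \<Longrightarrow> y \<in> B \<Longrightarrow> x < y" "\<And>y. y \<in> B \<Longrightarrow> 0 < y"
  obtains a b :: nat where "a > 0" "b > 0" "\<And>x. x \<in> A \<Longrightarrow> x < a / b" "\<And>y. y \<in> B \<Longrightarrow> a / b < y"
proof -
  define l where "l = Max (insert 0 A)"
  define h where "h = (if B = {} then l + 1 else Min B)"
  have "l < h"
  proof (cases "B = {}")
    case False
    then have "h \<in> B" using assms(2) by (simp add: h_def)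
    then show ?thesis using assms(1,3,4) by (simp add: l_def)
  qed (simp add: h_def)
  then obtain r where r: "r \<in> \<rat>" "l < r" "r < h" using Rats_dense_in_real by blast
  have "0 < r" using r(2) assms(1) by (simp add: l_def)
  then obtain a b :: nat where ab: "b \<noteq> 0" "r = real a / real b"
    using Rats_abs_nat_div_natE[OF r(1)] by (metis abs_of_pos)
  have "a > 0" using ab \<open>0 < r\<close> by (cases a) auto
  moreover have "x < r" if "x \<in> A" for x
  proof -
    have "x \<le> l" unfolding l_def using that assms(1) by (intro Max_ge) auto
    then show ?thesis using r(2) by simp
  qed
  moreover have "r < y" if "y \<in> B" for y
    using r(3) that assms(2) unfolding h_def by (auto split: if_splits)
  ultimately show thesis using that[of a b] ab by simp
qed

text \<open>
  Along \<open>g\<close> the monomials in \<open>S\<close> are ranked by the weight \<open>b i + a j\<close>: of two monomials of different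
  weights the one of smaller weight is larger by an order of magnitude.
\<close>

definition monomials_separated :: "(nat \<times> nat) set \<Rightarrow> nat \<Rightarrow> nat \<Rightarrow> 'a filter \<Rightarrow> ('a \<Rightarrow> real \<times> real) \<Rightarrow> bool" where
  "monomials_separated S a b F g \<longleftrightarrow>
     (\<forall>(i, j)\<in>S. \<forall>(k, l)\<in>S. b * i + a * j < b * k + a * l \<longrightarrow>
        (\<lambda>x. fst (g x) ^ k * snd (g x) ^ l) \<in> o[F](\<lambda>x. fst (g x) ^ i * snd (g x) ^ j))"

lemma monomials_separated_on_curve:
  "monomials_separated S a b (at_right 0) (\<lambda>\<tau>. (\<tau> ^ b, \<tau> ^ a))"
  unfolding monomials_separated_def
proof clarify
  fix i j k l :: nat
  assume lt: "b * i + a * j < b * k + a * l"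
  define n where "n = b * k + a * l - (b * i + a * j)"
  have n: "n > 0" "b * k + a * l = n + (b * i + a * j)" using lt by (simp_all add: n_def)
  have "((\<lambda>\<tau>::real. \<tau> ^ n) \<longlongrightarrow> 0 ^ n) (at_right 0)" by (intro tendsto_intros)
  then have "((\<lambda>\<tau>::real. \<tau> ^ n) \<longlongrightarrow> 0) (at_right 0)" using n(1) by (simp add: zero_power)
  then have "(\<lambda>\<tau>::real. \<tau> ^ (b * k + a * l)) \<in> o[at_right 0](\<lambda>\<tau>. \<tau> ^ (b * i + a * j))"
    by (rule smallo_mult_self) (simp add: n(2) power_add)
  then show "(\<lambda>\<tau>::real. fst (\<tau> ^ b, \<tau> ^ a) ^ k * snd (\<tau> ^ b, \<tau> ^ a) ^ l)
      \<in> o[at_right 0](\<lambda>\<tau>. fst (\<tau> ^ b, \<tau> ^ a) ^ i * snd (\<tau> ^ b, \<tau> ^ a) ^ j)"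
    by (simp add: power_add power_mult)
qed

text \<open>
  Two monomials \<open>t^i u^j\<close> and \<open>t^k u^l\<close> with \<open>j \<noteq> l\<close> compare like \<open>u\<close> and \<open>t^r\<close>, where
  \<open>r = (i - k) / (l - j)\<close>.  On a subsequence \<open>u / t^r\<close> converges in the extended reals for each of these
  finitely many slopes.  If some limit is finite and nonzero, \<open>u\<close> is proportional to \<open>t^r\<close>.  Otherwise the
  slopes with limit 0 lie below those with infinite limit, and any positive rational number \<open>a / b\<close> between the
  two groups gives weights with the right ranking.
\<close>

lemma proportional_or_separated:
  fixes t u :: "nat \<Rightarrow> real"
  assumes S: "finite S"
    and t: "filterlim t (at_right 0) sequentially" and u: "u \<longlonglongrightarrow> 0"
  obtains
    (proportional) \<sigma> a b c where "strict_mono (\<sigma> :: nat \<Rightarrow> nat)" "a > 0" "b > 0" "coprime a b" "c \<noteq> 0"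
      "(\<lambda>n. u (\<sigma> n) / t (\<sigma> n) powr (real a / real b)) \<longlonglongrightarrow> c"
  | (separated) \<sigma> a b where "strict_mono (\<sigma> :: nat \<Rightarrow> nat)" "a > 0" "b > 0"
      "inj_on (\<lambda>(i, j). b * i + a * j) S"
      "monomials_separated S a b sequentially (\<lambda>n. (t (\<sigma> n), u (\<sigma> n)))"
proof -
  define slope where "slope = (\<lambda>((i, j), (k, l)). (real i - real k) / (real l - real j))"
  define R where "R = slope ` (S \<times> S)"
  have "finite R" unfolding R_def using S by blast
  obtain \<sigma> where \<sigma>: "strict_mono \<sigma>"
    and conv: "\<And>r. r \<in> R \<Longrightarrow> \<exists>L. (\<lambda>n. ereal (u (\<sigma> n) / t (\<sigma> n) powr r)) \<longlonglongrightarrow> L"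
    using ereal_subsequences[OF \<open>finite R\<close>, of "\<lambda>r n. ereal (u n / t n powr r)"] by metis
  define T where "T n = t (\<sigma> n)" for n
  define U where "U n = u (\<sigma> n)" for n
  have T: "filterlim T (at_right 0) sequentially"
    unfolding T_def using filterlim_compose[OF t filterlim_subseq[OF \<sigma>]] .
  have U: "U \<longlonglongrightarrow> 0" unfolding U_def using LIMSEQ_subseq_LIMSEQ[OF u \<sigma>] by (simp add: o_def)
  have T0: "T \<longlonglongrightarrow> 0" and T_pos: "\<forall>\<^sub>F n in sequentially. T n > 0"
    using T by (auto simp: filterlim_at elim: eventually_mono)
  have U_nonpos: "(\<lambda>n. U n / T n powr r) \<longlonglongrightarrow> 0" if "r \<le> 0" for r
  proof (rule tendsto_powr_scale_down[OF T _ that])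
    have "\<forall>\<^sub>F n in sequentially. U n = U n / T n powr 0" using T_pos by eventually_elim simp
    with U show "(\<lambda>n. U n / T n powr 0) \<longlonglongrightarrow> 0" by (rule Lim_transform_eventually)
  qed
  show thesis
  proof (cases "\<exists>r\<in>R. \<exists>c. c \<noteq> 0 \<and> (\<lambda>n. U n / T n powr r) \<longlonglongrightarrow> c")
    case True
    then obtain r c where rc: "r \<in> R" "c \<noteq> 0" "(\<lambda>n. U n / T n powr r) \<longlonglongrightarrow> c" by blast
    have "r > 0"
    proof (rule ccontr)
      assume "\<not> r > 0"
      then have "(\<lambda>n. U n / T n powr r) \<longlonglongrightarrow> 0" by (intro U_nonpos) simp
      then show False using rc(2) LIMSEQ_unique[OF rc(3)] by blast
    qed
    have "r \<in> \<rat>" using rc(1) unfolding R_def slope_def by (auto intro!: Rats_divide Rats_diff)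
    then obtain a b :: nat where ab: "b \<noteq> 0" "\<bar>r\<bar> = real a / real b" "coprime a b"
      by (rule Rats_abs_nat_div_natE)
    then have "r = real a / real b" "a > 0" using \<open>r > 0\<close> by (auto intro!: Nat.gr0I)
    then show thesis using proportional[OF \<sigma>, of a b c] ab rc by (simp add: T_def U_def)
  next
    case False
    (* the slopes below the cut *)
    define A where "A = {r \<in> R. (\<lambda>n. U n / T n powr r) \<longlonglongrightarrow> 0}"
    have inf: "\<forall>\<^sub>F n in sequentially. U n \<noteq> 0" "(\<lambda>n. T n powr r / U n) \<longlonglongrightarrow> 0"
      if r: "r \<in> R - A" for r
    proof -
      obtain L where L: "(\<lambda>n. ereal (U n / T n powr r)) \<longlonglongrightarrow> L"
        using conv r by (auto simp: T_def U_def)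
      have "\<bar>L\<bar> = \<infinity>"
      proof (cases L)
        case (real c)
        then have "(\<lambda>n. U n / T n powr r) \<longlonglongrightarrow> c" using L by simp
        then show ?thesis using r False by (cases "c = 0") (auto simp: A_def)
      qed auto
      then have "filterlim (\<lambda>n. U n / T n powr r) at_infinity sequentially"
      proof (cases "L = \<infinity>")
        case True
        then have "filterlim (\<lambda>n. U n / T n powr r) at_top sequentially"
          using L by (simp add: tendsto_PInfty_eq_at_top)
        then show ?thesis by (rule filterlim_at_top_imp_at_infinity)
      next
        case False
        then have "L = - \<infinity>" using \<open>\<bar>L\<bar> = \<infinity>\<close> by (cases L) auto
        then have "filterlim (\<lambda>n. U n / T n powr r) at_bot sequentially"
          using L by (simp add: tendsto_MInfty filterlim_at_bot_dense)
        then show ?thesis by (rule filterlim_mono[OF _ at_bot_le_at_infinity order_refl])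
      qed
      then have "(\<lambda>n. inverse (U n / T n powr r)) \<longlonglongrightarrow> 0"
        and "\<forall>\<^sub>F n in sequentially. U n / T n powr r \<noteq> 0"
        by (rule filterlim_compose[OF tendsto_inverse_0], rule filterlim_at_infinity_imp_eventually_ne)
      then show "\<forall>\<^sub>F n in sequentially. U n \<noteq> 0" "(\<lambda>n. T n powr r / U n) \<longlonglongrightarrow> 0"
        by (auto elim: eventually_mono)
    qed
    obtain a b :: nat where ab: "a > 0" "b > 0" "\<And>r. r \<in> A \<Longrightarrow> r < a / b" "\<And>r. r \<in> R - A \<Longrightarrow> a / b < r"
    proof (rule rational_cut[of A "R - A"])
      show "finite A" "finite (R - A)" using \<open>finite R\<close> by (auto simp: A_def)
      show "x < y" if "x \<in> A" "y \<in> R - A" for x y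
      proof (rule ccontr)
        assume "\<not> x < y"
        then have "(\<lambda>n. U n / T n powr y) \<longlonglongrightarrow> 0"
          using that(1) by (intro tendsto_powr_scale_down[OF T, of U x y]) (auto simp: A_def)
        then show False using that(2) by (auto simp: A_def)
      qed
      show "0 < y" if "y \<in> R - A" for y
      proof (rule ccontr)
        assume "\<not> 0 < y"
        then have "(\<lambda>n. U n / T n powr y) \<longlonglongrightarrow> 0" by (intro U_nonpos) simp
        then show False using that by (auto simp: A_def)
      qed
    qed blast
    have slopeR: "(real i - real k) / (real l - real j) \<in> R" if "(i, j) \<in> S" "(k, l) \<in> S" for i j k l
      unfolding R_def slope_def using that by force
    have weight: "real (b * i + a * j) - real (b * k + a * l)
        = real b * (real l - real j) * ((real i - real k) / (real l - real j) - real a / real b)"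
      if "j \<noteq> l" for i j k l :: nat
      using that ab(2) by (simp add: field_simps)
    have "inj_on (\<lambda>(i, j). b * i + a * j) S"
    proof (rule inj_onI, clarify)
      fix i j k l
      assume S: "(i, j) \<in> S" "(k, l) \<in> S" and eq: "b * i + a * j = b * k + a * l"
      have "j = l"
      proof (rule ccontr)
        assume "j \<noteq> l"
        then have "(real i - real k) / (real l - real j) = real a / real b"
          using weight[of j l i k] eq ab(2) by simp
        then show False using slopeR[OF S] ab(3)[of "real a / real b"] ab(4)[of "real a / real b"] by auto
      qed
      then show "i = k \<and> j = l" using eq ab(2) by simp
    qed
    moreover have "monomials_separated S a b sequentially (\<lambda>n. (T n, U n))"
      unfolding monomials_separated_def
    proof (clarify, unfold fst_conv snd_conv)
      fix i j k l
      assume S: "(i, j) \<in> S" "(k, l) \<in> S" and lt: "b * i + a * j < b * k + a * l"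
      let ?r = "(real i - real k) / (real l - real j)"
      consider "l = j" | "j < l" | "l < j" by linarith
      then show "(\<lambda>n. T n ^ k * U n ^ l) \<in> o(\<lambda>n. T n ^ i * U n ^ j)"
      proof cases
        case 1
        then have "i < k" using lt ab(2) by simp
        have "(\<lambda>n. T n ^ (k - i)) \<longlonglongrightarrow> 0 ^ (k - i)" by (intro tendsto_intros T0)
        then have "(\<lambda>n. T n ^ (k - i)) \<longlonglongrightarrow> 0" using \<open>i < k\<close> by (simp add: zero_power)
        moreover have "T n ^ k = T n ^ (k - i) * T n ^ i" for n
          using \<open>i < k\<close> by (simp flip: power_add)
        then have "\<forall>\<^sub>F n in sequentially. T n ^ k * U n ^ l = T n ^ (k - i) * (T n ^ i * U n ^ j)"
          using 1 by (intro always_eventually) (metis mult.assoc)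
        ultimately show ?thesis by (rule smallo_mult_self)
      next
        case 2
        have "real b * (real l - real j) * (?r - real a / real b) < 0"
          using weight[of j l i k] 2 lt by linarith
        then have "?r < real a / real b" using 2 ab(2) by (simp add: mult_less_0_iff)
        then have "?r \<in> A" using slopeR[OF S] ab(4)[of ?r] by (meson DiffI not_less_iff_gr_or_eq)
        then have "(\<lambda>n. (U n / T n powr ?r) ^ (l - j)) \<longlonglongrightarrow> 0 ^ (l - j)"
          unfolding A_def by (intro tendsto_power) auto
        then have "(\<lambda>n. (U n / T n powr ?r) ^ (l - j)) \<longlonglongrightarrow> 0" using 2 by (simp add: zero_power)
        moreover have "\<forall>\<^sub>F n in sequentially. T n ^ k * U n ^ l = (U n / T n powr ?r) ^ (l - j) * (T n ^ i * U n ^ j)"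
          using T_pos
        proof eventually_elim
          case (elim n)
          have "(T n powr ?r) ^ (l - j) = T n powr (?r * real (l - j))"
            using elim by (simp add: powr_powr flip: powr_realpow)
          also have "?r * real (l - j) = real i - real k" using 2 by (simp add: of_nat_diff)
          also have "T n powr (real i - real k) = T n ^ i / T n ^ k"
            using elim by (simp add: powr_diff powr_realpow)
          finally have p: "(T n powr ?r) ^ (l - j) = T n ^ i / T n ^ k" .
          have "U n ^ l = U n ^ (l - j) * U n ^ j" using 2 by (simp flip: power_add)
          then show ?case unfolding power_divide p using elim by (simp add: field_simps)
        qed
        ultimately show ?thesis by (rule smallo_mult_self)
      next
        case 3
        have "real b * (real l - real j) * (?r - real a / real b) < 0"
          using weight[of j l i k] 3 lt by linarith
        then have "real a / real b < ?r" using 3 ab(2) by (simp add: mult_less_0_iff zero_less_mult_iff)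
        then have r: "?r \<in> R - A" using slopeR[OF S] ab(3)[of ?r] by (meson DiffI not_less_iff_gr_or_eq)
        from inf(2)[OF r] have "(\<lambda>n. (T n powr ?r / U n) ^ (j - l)) \<longlonglongrightarrow> 0 ^ (j - l)"
          by (rule tendsto_power)
        then have "(\<lambda>n. (T n powr ?r / U n) ^ (j - l)) \<longlonglongrightarrow> 0" using 3 by (simp add: zero_power)
        moreover have "\<forall>\<^sub>F n in sequentially. T n ^ k * U n ^ l = (T n powr ?r / U n) ^ (j - l) * (T n ^ i * U n ^ j)"
          using T_pos inf(1)[OF r]
        proof eventually_elim
          case (elim n)
          have "(T n powr ?r) ^ (j - l) = T n powr (?r * real (j - l))"
            using elim by (simp add: powr_powr flip: powr_realpow)
          also have "?r * real (j - l) = real k - real i" using 3 by (simp add: of_nat_diff field_simps)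
          also have "T n powr (real k - real i) = T n ^ k / T n ^ i"
            using elim by (simp add: powr_diff powr_realpow)
          finally have p: "(T n powr ?r) ^ (j - l) = T n ^ k / T n ^ i" .
          have "U n ^ j = U n ^ (j - l) * U n ^ l" using 3 by (simp flip: power_add)
          then show ?case unfolding power_divide p using elim by (simp add: field_simps)
        qed
        ultimately show ?thesis by (rule smallo_mult_self)
      qed
    qed
    ultimately show thesis using separated[OF \<sigma> ab(1,2)] by (simp add: T_def U_def)
  qed
qed

lemma dominant_monomial_asymp_equiv:
  assumes S: "supp P \<subseteq> S" and inj: "inj_on (\<lambda>(i, j). b * i + a * j) S"
    and ij: "(i, j) \<in> supp P" and min: "\<And>k l. (k, l) \<in> supp P \<Longrightarrow> b * i + a * j \<le> b * k + a * l"
    and sep: "monomials_separated S a b F g"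
  shows "(\<lambda>x. ev P (g x)) \<sim>[F] (\<lambda>x. coeff (coeff P j) i * (fst (g x) ^ i * snd (g x) ^ j))"
proof (rule smallo_imp_asymp_equiv)
  let ?m = "\<lambda>(k, l) x. fst (g x) ^ k * snd (g x) ^ l"
  let ?c = "\<lambda>(k, l). coeff (coeff P l) k"
  have c0: "?c (i, j) \<noteq> 0" using ij by (simp add: supp_def)
  have "(\<lambda>x. \<Sum>kl\<in>supp P - {(i, j)}. ?c kl * ?m kl x) \<in> o[F](?m (i, j))"
  proof (rule big_sum_in_smallo)
    fix kl assume kl: "kl \<in> supp P - {(i, j)}"
    obtain k l where [simp]: "kl = (k, l)" by (cases kl)
    have "b * i + a * j \<noteq> b * k + a * l"
      using inj_onD[OF inj, of "(i, j)" "(k, l)"] kl ij S by auto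
    then have "b * i + a * j < b * k + a * l" using min[of k l] kl by simp
    then have "?m kl \<in> o[F](?m (i, j))"
      using sep kl ij S unfolding monomials_separated_def by fastforce
    then show "(\<lambda>x. ?c kl * ?m kl x) \<in> o[F](?m (i, j))" by simp
  qed
  moreover have "ev P (g x) - ?c (i, j) * ?m (i, j) x = (\<Sum>kl\<in>supp P - {(i, j)}. ?c kl * ?m kl x)" for x
    using ev_eq_sum[of P "fst (g x)" "snd (g x)"] sum.remove[OF finite_supp ij, of "\<lambda>kl. ?c kl * ?m kl x"]
    by (simp add: case_prod_unfold)
  ultimately have "(\<lambda>x. ev P (g x) - ?c (i, j) * ?m (i, j) x) \<in> o[F](?m (i, j))" by simp
  then show "(\<lambda>x. ev P (g x) - coeff (coeff P j) i * (fst (g x) ^ i * snd (g x) ^ j))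
      \<in> o[F](\<lambda>x. coeff (coeff P j) i * (fst (g x) ^ i * snd (g x) ^ j))"
    using c0 by simp
qed

section \<open>Newton's algorithm\<close>

text \<open>
  The situation at one stage of the algorithm.  The quotient under study is \<open>P / D\<close>.  From \<open>D\<close> a power of
  \<open>t\<close> has been split off so that \<open>Q(0, u)\<close> has a nonzero coefficient of degree \<open>m\<close>.  The pair \<open>(m, K)\<close>
  is the termination measure.  The chart variables change from stage to stage, hence the sequence is
  hidden behind an existential quantifier.
\<close>

definition newton_state :: "poly_xy \<Rightarrow> poly_xy \<Rightarrow> poly_xy \<Rightarrow> nat \<Rightarrow> nat \<Rightarrow> nat \<Rightarrow> real \<Rightarrow> bool" where
  "newton_state P D Q w m K d \<longleftrightarrow>
     coeff (coeff Q m) 0 \<noteq> 0 \<and>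
     (\<forall>z. ev D z = fst z ^ w * ev Q z) \<and>
     (\<exists>M. \<forall>\<^sub>F z in corner. \<bar>ev P z\<bar> \<le> M * \<bar>ev D z\<bar>) \<and>
     (\<exists>\<epsilon>>0. \<forall>\<^sub>F z in corner. \<epsilon> * fst z ^ K \<le> \<bar>ev Q z\<bar>) \<and>
     (\<exists>g :: nat \<Rightarrow> real \<times> real. filterlim g corner sequentially \<and>
        (\<lambda>n. ev P (g n) / ev D (g n)) \<longlonglongrightarrow> d)"

definition has_arc :: "poly_xy \<Rightarrow> poly_xy \<Rightarrow> real \<Rightarrow> bool" where
  "has_arc P D d \<longleftrightarrow> (\<exists>s \<Psi>. s > 0 \<and> poly \<Psi> 0 = 0 \<and>
     ((\<lambda>\<tau>. ev P (\<tau> ^ s, poly \<Psi> \<tau>) / ev D (\<tau> ^ s, poly \<Psi> \<tau>)) \<longlongrightarrow> d) (at_right 0))"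

lemma filterlim_power_at_right_0:
  assumes "s > 0" "filterlim f (at_right 0) F"
  shows "filterlim (\<lambda>x. f x ^ s :: real) (at_right 0) F"
proof -
  have "(f \<longlongrightarrow> 0) F" and pos: "\<forall>\<^sub>F x in F. f x > 0"
    using assms(2) by (auto simp: filterlim_at elim: eventually_mono)
  then have "((\<lambda>x. f x ^ s) \<longlongrightarrow> 0 ^ s) F" by (intro tendsto_power)
  moreover have "\<forall>\<^sub>F x in F. f x ^ s \<in> {0<..} \<and> f x ^ s \<noteq> 0" using pos by eventually_elim simp
  ultimately show ?thesis using assms(1) by (simp add: filterlim_at zero_power)
qed

lemma filterlim_arc_corner:
  assumes "s > 0" "poly \<Psi> 0 = 0"
  shows "filterlim (\<lambda>\<tau>. (\<tau> ^ s, poly \<Psi> \<tau>)) corner (at_right 0)"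
proof -
  have "(poly \<Psi> \<longlongrightarrow> poly \<Psi> 0) (at 0)" using poly_isCont by (simp add: isCont_def)
  then have "(poly \<Psi> \<longlongrightarrow> poly \<Psi> 0) (at_right 0)" by (rule tendsto_mono[OF at_le[OF subset_UNIV]])
  then show ?thesis
    unfolding corner_iff using assms filterlim_power_at_right_0[OF assms(1) filterlim_ident] by simp
qed

lemma denominator_nonzero_corner:
  assumes "newton_state P D Q w m K d"
  shows "\<forall>\<^sub>F z in corner. ev D z \<noteq> 0"
proof -
  obtain \<epsilon> where \<epsilon>: "\<epsilon> > 0" "\<forall>\<^sub>F z in corner. \<epsilon> * fst z ^ K \<le> \<bar>ev Q z\<bar>"
    and D: "\<And>z. ev D z = fst z ^ w * ev Q z"
    using assms unfolding newton_state_def by blast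
  from \<epsilon>(2) eventually_fst_corner_pos show ?thesis
  proof eventually_elim
    case (elim z)
    have "0 < \<epsilon> * fst z ^ K" using elim \<epsilon>(1) by simp
    then have "ev Q z \<noteq> 0" using elim by linarith
    then show ?case using elim by (simp add: D)
  qed
qed

text \<open>
  Here the quotient is continuous at the corner, so every arc does as well as the given sequence.
\<close>

lemma newton_base:
  assumes st: "newton_state P D Q w m K d" and unit: "ev Q (0, 0) \<noteq> 0"
  shows "has_arc P D d"
proof -
  obtain M g where M: "\<forall>\<^sub>F z in corner. \<bar>ev P z\<bar> \<le> M * \<bar>ev D z\<bar>"
    and D: "\<And>z. ev D z = fst z ^ w * ev Q z"
    and g: "filterlim g corner sequentially" "(\<lambda>n. ev P (g n) / ev D (g n)) \<longlonglongrightarrow> d"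
    using st unfolding newton_state_def by blast
  obtain L where "((\<lambda>z. ev P z / (fst z ^ w * ev Q z)) \<longlongrightarrow> L) corner"
    using bounded_quotient_tendsto_corner[OF unit M[unfolded D]] by blast
  then have L: "((\<lambda>z. ev P z / ev D z) \<longlongrightarrow> L) corner" by (simp add: D)
  have "(\<lambda>n. ev P (g n) / ev D (g n)) \<longlonglongrightarrow> L" using filterlim_compose[OF L g(1)] .
  then have "L = d" using LIMSEQ_unique g(2) by blast
  moreover have "filterlim (\<lambda>\<tau>. (\<tau> ^ 1, poly 0 \<tau>)) corner (at_right 0)"
    by (rule filterlim_arc_corner) auto
  ultimately show ?thesis
    unfolding has_arc_def using filterlim_compose[OF L] by (intro exI[of _ 1] exI[of _ 0]) auto
qed

text \<open>
  The limit does not mention \<open>F\<close> and \<open>g\<close>: it is read off from the monomials of least weight.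
  Numerator and denominator are asymptotic to these, and boundedness of the quotient excludes that the
  numerator dominates.  This is what lets a sequence be replaced by an arc.
\<close>

lemma dominant_quotient_limit:
  assumes S: "supp P \<union> supp D \<subseteq> S" and inj: "inj_on (\<lambda>(i, j). b * i + a * j) S"
    and ij: "(i, j) \<in> supp P" "\<And>i' j'. (i', j') \<in> supp P \<Longrightarrow> b * i + a * j \<le> b * i' + a * j'"
    and kl: "(k, l) \<in> supp D" "\<And>i' j'. (i', j') \<in> supp D \<Longrightarrow> b * k + a * l \<le> b * i' + a * j'"
    and sep: "monomials_separated S a b F g" and F: "F \<noteq> bot"
    and nz: "\<forall>\<^sub>F x in F. ev D (g x) \<noteq> 0" and bnd: "\<forall>\<^sub>F x in F. \<bar>ev P (g x)\<bar> \<le> M * \<bar>ev D (g x)\<bar>"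
  shows "((\<lambda>x. ev P (g x) / ev D (g x)) \<longlongrightarrow>
     (if (i, j) = (k, l) then coeff (coeff P j) i / coeff (coeff D l) k else 0)) F"
proof -
  define A where "A x = fst (g x) ^ i * snd (g x) ^ j" for x
  define B where "B x = fst (g x) ^ k * snd (g x) ^ l" for x
  define \<alpha> where "\<alpha> = coeff (coeff P j) i"
  define \<beta> where "\<beta> = coeff (coeff D l) k"
  have \<alpha>\<beta>: "\<alpha> \<noteq> 0" "\<beta> \<noteq> 0" using ij kl by (auto simp: \<alpha>_def \<beta>_def supp_def)
  have P: "(\<lambda>x. ev P (g x)) \<sim>[F] (\<lambda>x. \<alpha> * A x)"
    unfolding \<alpha>_def A_def using S by (intro dominant_monomial_asymp_equiv[OF _ inj ij sep]) auto
  have D: "(\<lambda>x. ev D (g x)) \<sim>[F] (\<lambda>x. \<beta> * B x)"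
    unfolding \<beta>_def B_def using S by (intro dominant_monomial_asymp_equiv[OF _ inj kl sep]) auto
  have B_nz: "\<forall>\<^sub>F x in F. B x \<noteq> 0"
    using asymp_equiv_eventually_zeros[OF D] nz by eventually_elim auto
  have PD: "(\<lambda>x. \<alpha> * A x / (\<beta> * B x)) \<sim>[F] (\<lambda>x. ev P (g x) / ev D (g x))"
    using asymp_equiv_divide[OF P D] by (rule asymp_equiv_symI)
  have mem: "(i, j) \<in> S" "(k, l) \<in> S" using ij kl S by auto
  consider "(i, j) = (k, l)" | "b * k + a * l < b * i + a * j" | "b * i + a * j < b * k + a * l"
    using inj_onD[OF inj _ mem] by fastforce
  then show ?thesis
  proof cases
    case 1
    then have "A = B" by (auto simp: A_def B_def)
    then have "\<forall>\<^sub>F x in F. \<alpha> / \<beta> = \<alpha> * A x / (\<beta> * B x)"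
      by (intro eventually_mono[OF B_nz]) simp
    then have "((\<lambda>x. \<alpha> * A x / (\<beta> * B x)) \<longlongrightarrow> \<alpha> / \<beta>) F"
      by (rule Lim_transform_eventually[OF tendsto_const])
    from asymp_equiv_tendsto_transfer[OF PD this] show ?thesis using 1 by (simp add: \<alpha>_def \<beta>_def)
  next
    case 2
    then have "A \<in> o[F](B)"
      using sep mem unfolding monomials_separated_def A_def B_def by fastforce
    then have "((\<lambda>x. A x / B x) \<longlongrightarrow> 0) F" by (rule smalloD_tendsto)
    from tendsto_mult_right_zero[OF this, of "\<alpha> / \<beta>"]
    have "((\<lambda>x. \<alpha> * A x / (\<beta> * B x)) \<longlongrightarrow> 0) F" by simp
    from asymp_equiv_tendsto_transfer[OF PD this] show ?thesis using 2 by auto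
  next
    case 3
    then have BA: "B \<in> o[F](A)"
      using sep mem unfolding monomials_separated_def A_def B_def by fastforce
    have "(\<lambda>x. ev P (g x)) \<in> \<Theta>[F](\<lambda>x. \<alpha> * A x)" "(\<lambda>x. ev D (g x)) \<in> \<Theta>[F](\<lambda>x. \<beta> * B x)"
      using asymp_equiv_imp_bigtheta[OF P] asymp_equiv_imp_bigtheta[OF D] .
    then have "A \<in> O[F](\<lambda>x. ev P (g x))" "(\<lambda>x. ev D (g x)) \<in> O[F](B)"
      using \<alpha>\<beta> by (auto simp: bigtheta_def bigomega_iff_bigo)
    moreover have "(\<lambda>x. ev P (g x)) \<in> O[F](\<lambda>x. ev D (g x))"
      using bnd by (intro bigoI[of _ M]) auto
    ultimately have "(\<lambda>x. ev D (g x)) \<in> o[F](\<lambda>x. ev D (g x))"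
      using BA by (meson landau_o.big_small_trans landau_o.big_trans landau_o.small_big_trans)
    then have "\<forall>\<^sub>F x in F. ev D (g x) = 0" by (simp add: landau_o.small_refl_iff)
    with nz have "\<forall>\<^sub>F x in F. False" by eventually_elim simp
    then show ?thesis using F by (simp add: eventually_False)
  qed
qed

lemma ex_minimal_weight:
  assumes "P \<noteq> 0"
  obtains i j where "(i, j) \<in> supp P" "\<And>i' j'. (i', j') \<in> supp P \<Longrightarrow> b * i + a * j \<le> b * i' + a * j'"
  using ex_is_arg_min_if_finite[OF finite_supp supp_nonempty[OF assms], of "\<lambda>(i, j). b * i + a * j"]
  by (fastforce simp: is_arg_min_linorder)

text \<open>
  On the arc \<open>(\<tau>^b, \<tau>^a)\<close> a monomial is \<open>\<tau>\<close> to the power of its weight.  So the monomials that dominate on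
  the sequence dominate on the arc as well.
\<close>

lemma newton_separated:
  assumes st: "newton_state P D Q w m K d"
    and ab: "a > 0" "b > 0" and inj: "inj_on (\<lambda>(i, j). b * i + a * j) (supp P \<union> supp D)"
    and g: "filterlim g corner sequentially" "(\<lambda>n. ev P (g n) / ev D (g n)) \<longlonglongrightarrow> d"
    and sep: "monomials_separated (supp P \<union> supp D) a b sequentially g"
  shows "has_arc P D d"
proof -
  have arc: "filterlim (\<lambda>\<tau>. (\<tau> ^ b, \<tau> ^ a)) corner (at_right 0)"
    using filterlim_arc_corner[OF ab(2), of "monom 1 a"] ab(1) by (simp add: poly_monom zero_power)
  obtain M where M: "\<forall>\<^sub>F z in corner. \<bar>ev P z\<bar> \<le> M * \<bar>ev D z\<bar>"
    using st unfolding newton_state_def by blast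
  note nz = denominator_nonzero_corner[OF st]
  have "((\<lambda>\<tau>. ev P (\<tau> ^ b, \<tau> ^ a) / ev D (\<tau> ^ b, \<tau> ^ a)) \<longlongrightarrow> d) (at_right 0)"
  proof (cases "P = 0")
    case True
    then show ?thesis using g(2) by (simp add: LIMSEQ_const_iff)
  next
    case False
    have "D \<noteq> 0" using nz corner_neq_bot by (auto simp: eventually_False)
    obtain i j where ij: "(i, j) \<in> supp P" "\<And>i' j'. (i', j') \<in> supp P \<Longrightarrow> b * i + a * j \<le> b * i' + a * j'"
      using ex_minimal_weight[OF False] by metis
    obtain k l where kl: "(k, l) \<in> supp D" "\<And>i' j'. (i', j') \<in> supp D \<Longrightarrow> b * k + a * l \<le> b * i' + a * j'"
      using ex_minimal_weight[OF \<open>D \<noteq> 0\<close>] by metis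
    note lim = dominant_quotient_limit[OF subset_refl inj ij kl]
    let ?L = "if (i, j) = (k, l) then coeff (coeff P j) i / coeff (coeff D l) k else 0"
    have "(\<lambda>n. ev P (g n) / ev D (g n)) \<longlonglongrightarrow> ?L"
      by (rule lim[OF _ _ sep _ eventually_compose_filterlim[OF nz g(1)] eventually_compose_filterlim[OF M g(1)]]) auto
    then have "?L = d" using LIMSEQ_unique g(2) by blast
    moreover have "((\<lambda>\<tau>. ev P (\<tau> ^ b, \<tau> ^ a) / ev D (\<tau> ^ b, \<tau> ^ a)) \<longlongrightarrow> ?L) (at_right 0)"
      by (rule lim[OF _ _ monomials_separated_on_curve _ eventually_compose_filterlim[OF nz arc]
            eventually_compose_filterlim[OF M arc]]) auto
    ultimately show ?thesis by simp
  qed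
  then show ?thesis
    unfolding has_arc_def using ab by (intro exI[of _ b] exI[of _ "monom 1 a"]) (simp add: poly_monom zero_power)
qed

lemma pcompose_power: "pcompose (p ^ n) q = pcompose p q ^ n" for p :: "'a::comm_semiring_1 poly"
  by (induction n) (simp_all add: pcompose_mult pcompose_1)

lemma coeff_order_translate:
  fixes E :: "real poly"
  assumes "E \<noteq> 0"
  shows "coeff (pcompose E [:c, 1:]) (order c E) \<noteq> 0"
proof -
  obtain q where q: "E = [:- c, 1:] ^ order c E * q" "\<not> [:- c, 1:] dvd q"
    using order_decomp[OF assms] by blast
  have "pcompose E [:c, 1:] = pcompose [:- c, 1:] [:c, 1:] ^ order c E * pcompose q [:c, 1:]"
    by (subst q(1)) (simp only: pcompose_mult pcompose_power)
  also have "pcompose [:- c, 1:] [:c, 1:] = monom 1 1" by (simp add: pcompose_pCons monom_altdef)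
  also have "monom 1 1 ^ order c E = monom 1 (order c E)" by (simp add: monom_power)
  finally have "coeff (pcompose E [:c, 1:]) (order c E) = coeff (pcompose q [:c, 1:]) 0"
    by (simp add: coeff_monom_mult)
  also have "\<dots> = poly q c" by (simp flip: poly_0_coeff_0 add: poly_pcompose)
  also have "\<dots> \<noteq> 0" using q(2) by (simp add: poly_eq_0_iff_dvd)
  finally show ?thesis .
qed

text \<open>
  A polynomial of degree at most \<open>m\<close> with a root of order \<open>m\<close> at \<open>c \<noteq> 0\<close> is a multiple of \<open>(T - c)^m\<close>, whose
  coefficient of \<open>T^(m - 1)\<close> is \<open>- m c\<close>.  In \<open>newton_substitution\<close> this yields two points of an edge in
  adjacent rows, which makes the slope an integer.
\<close>

lemma full_order_imp_subleading_coeff: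
  fixes E :: "real poly"
  assumes "E \<noteq> 0" "c \<noteq> 0" "degree E \<le> m" "order c E = m" "m > 0"
  shows "coeff E m \<noteq> 0" "coeff E (m - 1) \<noteq> 0"
proof -
  obtain q where q: "E = [:- c, 1:] ^ m * q" "\<not> [:- c, 1:] dvd q"
    using order_decomp[OF assms(1), of c] assms(4) by blast
  have "q \<noteq> 0" using q(2) by auto
  then have "degree E = m + degree q"
    by (subst q(1)) (simp add: degree_mult_eq degree_power_eq)
  then have "degree q = 0" using assms(3) by simp
  then obtain \<alpha> where \<alpha>: "q = [:\<alpha>:]" by (rule degree_eq_zeroE)
  then have E: "E = smult \<alpha> ([:- c, 1:] ^ m)" and "\<alpha> \<noteq> 0" using q(1) \<open>q \<noteq> 0\<close> by auto
  have "coeff ([:- c, 1:] ^ m) (m - 1) = of_nat (m choose (m - 1)) * 1 ^ (m - 1) * (- c) ^ (m - (m - 1))"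
    by (rule coeff_linear_poly_power) simp
  then show "coeff E (m - 1) \<noteq> 0" using E \<open>\<alpha> \<noteq> 0\<close> assms(2,5) by simp
  show "coeff E m \<noteq> 0" using E \<open>\<alpha> \<noteq> 0\<close> by (simp add: coeff_linear_power)
qed

text \<open>
  With \<open>t = \<tau>^b\<close> and \<open>u = \<tau>^a (c + v)\<close> the new \<open>Q\<close> at \<open>\<tau> = 0\<close> is \<open>E(c + v)\<close>, where \<open>E\<close> is an edge polynomial of
  \<open>Q\<close>.  The point \<open>(0, m)\<close> of the support confines the edge to degrees at most \<open>m\<close>, so the order of \<open>E\<close>
  at \<open>c\<close> is at most \<open>m\<close>.  In case of equality \<open>E\<close> has coefficients in degrees \<open>m\<close> and \<open>m - 1\<close>, hence \<open>b\<close>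
  divides \<open>a\<close>; then \<open>b = 1\<close> and \<open>K\<close> drops by the weight \<open>W = a m\<close> of the edge.
\<close>

lemma newton_substitution:
  assumes st: "newton_state P D Q w m K d" and Q00: "ev Q (0, 0) = 0"
    and ab: "a > 0" "b > 0" "coprime a b" and "c \<noteq> 0"
    and g: "filterlim g corner sequentially" "(\<lambda>n. ev P (g n) / ev D (g n)) \<longlonglongrightarrow> d"
    and lim: "(\<lambda>n. snd (g n) / fst (g n) powr (real a / real b)) \<longlonglongrightarrow> c"
  obtains P' D' Q' w' m' K' where "newton_state P' D' Q' w' m' K' d"
    "m' < m \<or> m' = m \<and> K' < K" "has_arc P' D' d \<Longrightarrow> has_arc P D d"
proof -
  define \<phi> :: "real \<times> real \<Rightarrow> real \<times> real" where "\<phi> z = (fst z ^ b, fst z ^ a * (c + snd z))" for z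
  obtain M \<epsilon> where Qm: "coeff (coeff Q m) 0 \<noteq> 0" and D: "\<And>z. ev D z = fst z ^ w * ev Q z"
    and M: "\<forall>\<^sub>F z in corner. \<bar>ev P z\<bar> \<le> M * \<bar>ev D z\<bar>"
    and \<epsilon>: "\<epsilon> > 0" "\<forall>\<^sub>F z in corner. \<epsilon> * fst z ^ K \<le> \<bar>ev Q z\<bar>"
    using st unfolding newton_state_def by blast
  have XY: "ev [:monom 1 b:] z = fst z ^ b" "ev ([:monom 1 a:] * [:[:c:], 1:]) z = fst z ^ a * (c + snd z)"
    "ev [:[:0, 1:]:] z = fst z" "ev [:[:c:], 1:] z = c + snd z" for z
    by (simp_all add: ev_def poly_monom algebra_simps)
  obtain P' D' where P': "\<And>z. ev P' z = ev P (\<phi> z)" and D': "\<And>z. ev D' z = ev D (\<phi> z)"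
    using ex_poly_xy_compose[of _ "[:monom 1 b:]" "[:monom 1 a:] * [:[:c:], 1:]"] unfolding XY \<phi>_def by metis
  have "Q \<noteq> 0" using Qm by auto
  obtain W G where G: "\<And>\<tau> v. ev Q (\<tau> ^ b, \<tau> ^ a * v) = \<tau> ^ W * ev G (\<tau>, v)" "slice0 G \<noteq> 0"
    "\<And>i j. (i, j) \<in> supp Q \<Longrightarrow> W \<le> b * i + a * j"
    "\<And>j. coeff (slice0 G) j \<noteq> 0 \<Longrightarrow> \<exists>i. (i, j) \<in> supp Q \<and> b * i + a * j = W"
    using weighted_initial_form[OF \<open>Q \<noteq> 0\<close> ab(2)] by metis
  obtain Q' where Q': "\<And>z. ev Q' z = ev G (fst z, c + snd z)"
    using ex_poly_xy_compose[of G "[:[:0, 1:]:]" "[:[:c:], 1:]"] unfolding XY by blast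
  define E where "E = slice0 G"
  define m' where "m' = order c E"
  have "slice0 Q' = pcompose E [:c, 1:]"
    by (rule poly_eq_poly_eq_iff[THEN iffD1], rule ext) (simp add: E_def poly_slice0 Q' poly_pcompose)
  then have Qm': "coeff (coeff Q' m') 0 \<noteq> 0"
    using coeff_order_translate[of E c] G(2) by (simp add: m'_def E_def flip: coeff_slice0)
  have W_le: "W \<le> a * m" using G(3)[of 0 m] Qm by (simp add: supp_def)
  have "m > 0"
  proof (rule Nat.gr0I)
    assume "m = 0"
    then have "poly (slice0 Q) 0 \<noteq> 0" using Qm by (simp add: poly_0_coeff_0 coeff_slice0)
    then show False using Q00 by (simp add: poly_slice0)
  qed
  have deg: "degree E \<le> m"
  proof (rule degree_le, clarify, rule ccontr)
    fix j assume "m < j" "coeff E j \<noteq> 0"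
    then obtain i where "b * i + a * j = W" using G(4)[of j] by (auto simp: E_def)
    then have "a * j \<le> a * m" using W_le by linarith
    then show False using \<open>m < j\<close> ab(1) by simp
  qed
  have "m' \<le> m" using order_degree[of E c] G(2) deg by (simp add: m'_def E_def)
  have same: "b = 1 \<and> 0 < W" if "m' = m"
  proof -
    have "coeff E m \<noteq> 0" "coeff E (m - 1) \<noteq> 0"
      using full_order_imp_subleading_coeff[OF _ \<open>c \<noteq> 0\<close> deg _ \<open>m > 0\<close>] G(2) that by (auto simp: m'_def E_def)
    then obtain i i' where i: "b * i + a * m = W" "b * i' + a * (m - 1) = W" using G(4) E_def by blast
    then have W: "W = a * m" using W_le by simp
    then have "b * i' = a" using i(2) \<open>m > 0\<close> by (cases m) auto
    then have "b dvd a" by auto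
    then have "b = 1" using ab(3) by (metis coprime_absorb_right nat_dvd_1_iff_1)
    then show ?thesis using W ab(1) \<open>m > 0\<close> by simp
  qed
  have "K > 0"
  proof (rule Nat.gr0I)
    assume "K = 0"
    have "((\<lambda>z. \<bar>ev Q z\<bar>) \<longlongrightarrow> \<bar>ev Q (0, 0)\<bar>) corner" by (intro tendsto_rabs tendsto_ev_corner)
    then have "\<epsilon> \<le> \<bar>ev Q (0, 0)\<bar>"
      using \<epsilon>(2) \<open>K = 0\<close> by (intro tendsto_lowerbound[OF _ _ corner_neq_bot]) auto
    then show False using \<epsilon>(1) Q00 by simp
  qed
  (* If b K < W, truncated subtraction gives exponent 0; the bound then holds because t < 1. *)
  define K' where "K' = b * K - W"
  have decr: "m' < m \<or> m' = m \<and> K' < K"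
    using \<open>m' \<le> m\<close> same \<open>K > 0\<close> by (auto simp: K'_def)

  have fst_corner: "filterlim fst (at_right 0) corner" and snd_corner: "(snd \<longlongrightarrow> 0) corner"
    using corner_iff[of "\<lambda>z. z" corner] filterlim_ident by auto
  then have fst0: "(fst \<longlongrightarrow> 0) corner" by (simp add: filterlim_at)
  have "((\<lambda>z. fst z ^ a * (c + snd z)) \<longlongrightarrow> 0 ^ a * (c + 0)) corner"
    by (intro tendsto_intros fst0 snd_corner)
  then have \<phi>: "filterlim \<phi> corner corner"
    unfolding corner_iff \<phi>_def using filterlim_power_at_right_0[OF ab(2) fst_corner] ab(1)
    by (simp add: zero_power)

  have "\<forall>\<^sub>F t in at_right (0::real). t < 1"
    using eventually_at_right_real[of 0 1] by (auto elim: eventually_mono)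
  from eventually_fst_corner[OF this] eventually_fst_corner_pos eventually_compose_filterlim[OF \<epsilon>(2) \<phi>]
  have lower: "\<forall>\<^sub>F z in corner. \<epsilon> * fst z ^ K' \<le> \<bar>ev Q' z\<bar>"
  proof eventually_elim
    case (elim z)
    let ?t = "fst z"
    have "ev Q (\<phi> z) = ?t ^ W * ev Q' z" using G(1) by (simp add: \<phi>_def Q')
    then have *: "\<epsilon> * ?t ^ (b * K) \<le> ?t ^ W * \<bar>ev Q' z\<bar>"
      using elim by (simp add: \<phi>_def abs_mult power_mult)
    have "?t ^ W * ?t ^ K' \<le> ?t ^ (b * K)"
      using elim unfolding K'_def by (simp add: power_decreasing flip: power_add)
    then have "\<epsilon> * (?t ^ W * ?t ^ K') \<le> \<epsilon> * ?t ^ (b * K)"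
      using \<epsilon>(1) by (intro mult_left_mono) auto
    then have "?t ^ W * (\<epsilon> * ?t ^ K') \<le> ?t ^ W * \<bar>ev Q' z\<bar>" using * by (simp add: mult_ac)
    then show ?case using elim by simp
  qed

  (* the given sequence in the coordinates (\<tau>, v) *)
  define h where "h n = (fst (g n) powr (1 / b), snd (g n) / fst (g n) powr (a / b) - c)" for n
  have g_fst: "(\<lambda>n. fst (g n)) \<longlonglongrightarrow> 0" and g_pos: "\<forall>\<^sub>F n in sequentially. fst (g n) > 0"
    using g(1) unfolding corner_iff by (auto simp: filterlim_at elim: eventually_mono)
  have "(\<lambda>n. fst (g n) powr (1 / b)) \<longlonglongrightarrow> 0 powr (1 / b)"
    using ab(2) g_pos by (intro tendsto_powr2 g_fst tendsto_const) (auto elim: eventually_mono)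
  then have "filterlim (\<lambda>n. fst (h n)) (at_right 0) sequentially"
    unfolding filterlim_at h_def using g_pos by (auto elim: eventually_mono)
  moreover have "(\<lambda>n. snd (h n)) \<longlonglongrightarrow> 0" using tendsto_diff[OF lim tendsto_const[of c]] by (simp add: h_def)
  ultimately have h: "filterlim h corner sequentially" unfolding corner_iff by blast
  have "\<forall>\<^sub>F n in sequentially. ev P (g n) / ev D (g n) = ev P' (h n) / ev D' (h n)"
    using g_pos
  proof eventually_elim
    case (elim n)
    have "(fst (g n) powr (1 / b)) ^ k = fst (g n) powr (k / b)" for k :: nat
      using elim by (simp add: powr_powr flip: powr_realpow)
    then have "\<phi> (h n) = g n" using elim ab(2) by (simp add: \<phi>_def h_def)
    then show ?case by (simp add: P' D')
  qed
  with g(2) have h_lim: "(\<lambda>n. ev P' (h n) / ev D' (h n)) \<longlonglongrightarrow> d" by (rule Lim_transform_eventually)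

  have st1: "\<forall>z. ev D' z = fst z ^ (b * w + W) * ev Q' z"
    using G(1) by (simp add: D' D Q' \<phi>_def power_add power_mult)
  have st2: "\<exists>M. \<forall>\<^sub>F z in corner. \<bar>ev P' z\<bar> \<le> M * \<bar>ev D' z\<bar>"
    unfolding P' D' by (rule exI[of _ M], rule eventually_compose_filterlim[OF M \<phi>])
  have st3: "\<exists>\<epsilon>>0. \<forall>\<^sub>F z in corner. \<epsilon> * fst z ^ K' \<le> \<bar>ev Q' z\<bar>"
    by (rule exI[of _ \<epsilon>], rule conjI[OF \<epsilon>(1) lower])
  have st4: "\<exists>g. filterlim g corner sequentially \<and> (\<lambda>n. ev P' (g n) / ev D' (g n)) \<longlonglongrightarrow> d"
    by (rule exI[of _ h], rule conjI[OF h h_lim])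
  have new: "newton_state P' D' Q' (b * w + W) m' K' d"
    unfolding newton_state_def by (intro conjI Qm' st1 st2 st3 st4)
  have "has_arc P D d" if arc: "has_arc P' D' d"
  proof -
    obtain s \<Psi> where s: "s > 0" "poly \<Psi> 0 = 0"
      "((\<lambda>\<tau>. ev P' (\<tau> ^ s, poly \<Psi> \<tau>) / ev D' (\<tau> ^ s, poly \<Psi> \<tau>)) \<longlongrightarrow> d) (at_right 0)"
      using arc unfolding has_arc_def by blast
    define \<Theta> where "\<Theta> = monom 1 (s * a) * ([:c:] + \<Psi>)"
    have "\<phi> (\<tau> ^ s, poly \<Psi> \<tau>) = (\<tau> ^ (s * b), poly \<Theta> \<tau>)" for \<tau>
      by (simp add: \<phi>_def \<Theta>_def poly_monom power_mult)
    then have "((\<lambda>\<tau>. ev P (\<tau> ^ (s * b), poly \<Theta> \<tau>) / ev D (\<tau> ^ (s * b), poly \<Theta> \<tau>)) \<longlongrightarrow> d) (at_right 0)"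
      using s(3) by (simp add: P' D')
    moreover have "poly \<Theta> 0 = 0" using s(1) ab(1) by (simp add: \<Theta>_def poly_monom zero_power)
    ultimately show ?thesis unfolding has_arc_def using s(1) ab(2) by (intro exI[of _ "s * b"] exI[of _ \<Theta>]) simp
  qed
  then show thesis by (rule that[OF new decr])
qed

theorem newton_state_has_arc: "newton_state P D Q w m K d \<Longrightarrow> has_arc P D d"
proof (induction "(m, K)" arbitrary: P D Q w m K rule: wf_induct_rule[OF wf_lex_prod[OF wf_less_than wf_less_than]])
  case (1 m K)
  show ?case
  proof (cases "ev Q (0, 0) = 0")
    case False
    then show ?thesis using newton_base 1(2) by blast
  next
    case True
    obtain g where g: "filterlim g corner sequentially" "(\<lambda>n. ev P (g n) / ev D (g n)) \<longlonglongrightarrow> d"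
      using 1(2) unfolding newton_state_def by blast
    have sub: "filterlim (\<lambda>n. g (\<sigma> n)) corner sequentially"
      "(\<lambda>n. ev P (g (\<sigma> n)) / ev D (g (\<sigma> n))) \<longlonglongrightarrow> d" if "strict_mono \<sigma>" for \<sigma>
      using filterlim_compose[OF g(1) filterlim_subseq[OF that]] filterlim_compose[OF g(2) filterlim_subseq[OF that]] .
    have "finite (supp P \<union> supp D)" using finite_supp by blast
    from proportional_or_separated[OF this conjunct1[OF g(1)[unfolded corner_iff]]
        conjunct2[OF g(1)[unfolded corner_iff]], case_names proportional separated]
    show ?thesis
    proof cases
      case (proportional \<sigma> a b c)
      obtain P' D' Q' w' m' K' where new: "newton_state P' D' Q' w' m' K' d"
        "m' < m \<or> m' = m \<and> K' < K" "has_arc P' D' d \<Longrightarrow> has_arc P D d"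
        using newton_substitution[OF 1(2) True proportional(2-5) sub[OF proportional(1)] proportional(6)] by blast
      then have "has_arc P' D' d" by (intro 1(1)[OF _ new(1)]) auto
      then show ?thesis by (rule new(3))
    next
      case (separated \<sigma> a b)
      show ?thesis
        using newton_separated[OF 1(2) separated(2-4) sub[OF separated(1)]] separated(5) by simp
    qed
  qed
qed

section \<open>Arcs realising limits of quotients\<close>

text \<open>
  The sign of \<open>x\<close> and the slope range over a compact set, and a convergent sequence of signs is
  eventually constant.
\<close>

lemma subseq_cone_direction:
  fixes x y :: "nat \<Rightarrow> real"
  assumes ne: "\<And>n. x n \<noteq> 0" and cone: "\<And>n. \<bar>y n\<bar> \<le> \<bar>x n\<bar>"
  obtains \<rho> \<sigma> \<mu> where "strict_mono (\<rho> :: nat \<Rightarrow> nat)" "\<sigma> = 1 \<or> \<sigma> = - 1"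
    "\<forall>\<^sub>F n in sequentially. x (\<rho> n) = \<sigma> * \<bar>x (\<rho> n)\<bar>" "(\<lambda>n. y (\<rho> n) / \<bar>x (\<rho> n)\<bar>) \<longlonglongrightarrow> \<mu>"
proof -
  have "compact ({- 1, 1 :: real} \<times> {- 1..1 :: real})"
    by (intro compact_Times compact_Icc) (simp add: finite_imp_compact)
  moreover have "(sgn (x n), y n / \<bar>x n\<bar>) \<in> {- 1, 1} \<times> {- 1..1}" for n
    using ne[of n] cone[of n] by (auto simp: sgn_real_def abs_le_iff field_simps)
  ultimately obtain l \<rho> where l: "l \<in> {- 1, 1 :: real} \<times> {- 1..1}" and \<rho>: "strict_mono (\<rho> :: nat \<Rightarrow> nat)"
    and lim: "((\<lambda>n. (sgn (x n), y n / \<bar>x n\<bar>)) \<circ> \<rho>) \<longlonglongrightarrow> l"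
    using compact_imp_seq_compact seq_compactE by (metis (no_types, lifting))
  have "(\<lambda>n. sgn (x (\<rho> n))) \<longlonglongrightarrow> fst l" using tendsto_fst[OF lim] by (simp add: o_def)
  from tendstoD[OF this, of 1] have "\<forall>\<^sub>F n in sequentially. x (\<rho> n) = fst l * \<bar>x (\<rho> n)\<bar>"
  proof (rule eventually_mono)
    fix n assume "dist (sgn (x (\<rho> n))) (fst l) < 1"
    then have "sgn (x (\<rho> n)) = fst l" using l ne[of "\<rho> n"] by (auto simp: dist_real_def sgn_real_def split: if_splits)
    then show "x (\<rho> n) = fst l * \<bar>x (\<rho> n)\<bar>" by (metis mult.commute abs_mult_sgn)
  qed simp
  moreover have "(\<lambda>n. y (\<rho> n) / \<bar>x (\<rho> n)\<bar>) \<longlonglongrightarrow> snd l" using tendsto_snd[OF lim] by (simp add: o_def)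
  ultimately show thesis using that[OF \<rho>, of "fst l" "snd l"] l by auto
qed

text \<open>
  In the chart \<open>x = x0 + \<sigma> t\<close>, \<open>y = y0 + t (\<mu> + u)\<close> around the limiting direction \<open>\<mu>\<close> the sequence tends to the
  corner and Newton's algorithm applies.  The factor \<open>t\<close> in front of \<open>\<mu> + u\<close> is the reason why the final
  exponents are at least 1.
\<close>

lemma arc_selection_in_cone:
  fixes x y :: "nat \<Rightarrow> real"
  assumes pq: "coprime p q" "q \<noteq> 0"
    and bnd: "\<forall>\<^sub>F z in nhds (x0, y0). \<bar>ev p z\<bar> \<le> M * \<bar>ev q z\<bar>"
    and lim: "x \<longlonglongrightarrow> x0" "\<And>n. x n \<noteq> x0" "\<And>n. \<bar>y n - y0\<bar> \<le> \<bar>x n - x0\<bar>"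
    and d: "(\<lambda>n. ev p (x n, y n) / ev q (x n, y n)) \<longlonglongrightarrow> d"
  obtains \<sigma> s \<Theta> where "\<sigma> = 1 \<or> \<sigma> = - 1" "s > 0"
    "((\<lambda>\<tau>. ev p (x0 + \<sigma> * \<tau> ^ s, y0 + \<tau> ^ s * poly \<Theta> \<tau>) / ev q (x0 + \<sigma> * \<tau> ^ s, y0 + \<tau> ^ s * poly \<Theta> \<tau>)) \<longlongrightarrow> d)
       (at_right 0)"
proof -
  obtain \<rho> \<sigma> \<mu> where \<rho>: "strict_mono (\<rho> :: nat \<Rightarrow> nat)" and \<sigma>: "\<sigma> = 1 \<or> \<sigma> = - 1"
    and sgn: "\<forall>\<^sub>F n in sequentially. x (\<rho> n) - x0 = \<sigma> * \<bar>x (\<rho> n) - x0\<bar>"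
    and \<mu>: "(\<lambda>n. (y (\<rho> n) - y0) / \<bar>x (\<rho> n) - x0\<bar>) \<longlonglongrightarrow> \<mu>"
    using subseq_cone_direction[of "\<lambda>n. x n - x0" "\<lambda>n. y n - y0"] lim(2,3) by auto
  define \<psi> :: "real \<times> real \<Rightarrow> real \<times> real" where "\<psi> z = (x0 + \<sigma> * fst z, y0 + fst z * (\<mu> + snd z))" for z
  have XY: "ev [:[:x0, \<sigma>:]:] z = x0 + \<sigma> * fst z"
    "ev ([:[:y0:]:] + [:[:0, 1:]:] * [:[:\<mu>:], 1:]) z = y0 + fst z * (\<mu> + snd z)" for z
    by (simp_all add: ev_def algebra_simps)
  obtain P D where P: "\<And>z. ev P z = ev p (\<psi> z)" and D: "\<And>z. ev D z = ev q (\<psi> z)"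
    using ex_poly_xy_compose[of _ "[:[:x0, \<sigma>:]:]" "[:[:y0:]:] + [:[:0, 1:]:] * [:[:\<mu>:], 1:]"]
    unfolding XY \<psi>_def by metis
  obtain c K where c: "c > 0" "\<forall>\<^sub>F z in nhds (x0, y0). c * \<bar>fst z - x0\<bar> ^ K \<le> \<bar>ev q z\<bar>"
    using denominator_lower_bound[OF pq bnd] .
  have "(fst \<longlongrightarrow> 0) corner" "(snd \<longlongrightarrow> 0) corner"
    using corner_iff[of "\<lambda>z. z" corner] filterlim_ident by (auto simp: filterlim_at)
  then have "(\<psi> \<longlongrightarrow> (x0 + \<sigma> * 0, y0 + 0 * (\<mu> + 0))) corner"
    unfolding \<psi>_def[abs_def] by (intro tendsto_intros)
  then have \<psi>: "filterlim \<psi> (nhds (x0, y0)) corner" by simp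
  have bndP: "\<forall>\<^sub>F z in corner. \<bar>ev P z\<bar> \<le> M * \<bar>ev D z\<bar>"
    unfolding P D by (rule eventually_compose_filterlim[OF bnd \<psi>])
  have lower: "\<forall>\<^sub>F z in corner. c * fst z ^ K \<le> \<bar>ev D z\<bar>"
    using eventually_compose_filterlim[OF c(2) \<psi>] eventually_fst_corner_pos
    by eventually_elim (use \<sigma> in \<open>auto simp: \<psi>_def D\<close>)
  have "D \<noteq> 0"
  proof
    assume "D = 0"
    from lower eventually_fst_corner_pos have "\<forall>\<^sub>F z in corner. False"
    proof eventually_elim
      case (elim z)
      have "0 < c * fst z ^ K" using elim c(1) by simp
      then show ?case using elim \<open>D = 0\<close> by simp
    qed
    then show False using corner_neq_bot by (simp add: eventually_False)
  qed
  obtain w Q where "\<And>\<tau> v. ev D (\<tau> ^ 1, \<tau> ^ 0 * v) = \<tau> ^ w * ev Q (\<tau>, v)" and Q: "slice0 Q \<noteq> 0"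
    using weighted_initial_form[OF \<open>D \<noteq> 0\<close> zero_less_one] by metis
  then have DQ: "ev D z = fst z ^ w * ev Q z" for z by (cases z) simp
  have "\<forall>\<^sub>F t in at_right (0::real). t < 1"
    using eventually_at_right_real[of 0 1] by (auto elim: eventually_mono)
  from lower eventually_fst_corner[OF this] eventually_fst_corner_pos
  have lowerQ: "\<forall>\<^sub>F z in corner. c * fst z ^ K \<le> \<bar>ev Q z\<bar>"
  proof eventually_elim
    case (elim z)
    have "fst z ^ w * \<bar>ev Q z\<bar> \<le> 1 * \<bar>ev Q z\<bar>"
      using elim by (intro mult_right_mono power_le_one) auto
    then show ?case using elim by (simp add: DQ abs_mult)
  qed

  define g where "g n = (\<bar>x (\<rho> n) - x0\<bar>, (y (\<rho> n) - y0) / \<bar>x (\<rho> n) - x0\<bar> - \<mu>)" for n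
  have "(\<lambda>n. x (\<rho> n)) \<longlonglongrightarrow> x0" using LIMSEQ_subseq_LIMSEQ[OF lim(1) \<rho>] by (simp add: o_def)
  then have "(\<lambda>n. \<bar>x (\<rho> n) - x0\<bar>) \<longlonglongrightarrow> 0" by (simp add: tendsto_rabs_zero LIM_zero)
  then have g: "filterlim g corner sequentially"
    unfolding corner_iff g_def using LIM_zero[OF \<mu>] lim(2) by (auto simp: filterlim_at)
  have "\<forall>\<^sub>F n in sequentially. ev p (x (\<rho> n), y (\<rho> n)) / ev q (x (\<rho> n), y (\<rho> n)) = ev P (g n) / ev D (g n)"
    using sgn
  proof eventually_elim
    case (elim n)
    have "\<psi> (g n) = (x (\<rho> n), y (\<rho> n))" using elim lim(2)[of "\<rho> n"] by (simp add: \<psi>_def g_def)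
    then show ?case by (simp add: P D)
  qed
  then have "(\<lambda>n. ev P (g n) / ev D (g n)) \<longlonglongrightarrow> d"
    by (rule Lim_transform_eventually[rotated]) (use LIMSEQ_subseq_LIMSEQ[OF d \<rho>] in \<open>simp add: o_def\<close>)
  then have "newton_state P D Q w (degree (slice0 Q)) K d"
    unfolding newton_state_def using Q c(1) DQ bndP lowerQ g by (auto simp flip: coeff_slice0)
  from newton_state_has_arc[OF this] obtain s \<Psi> where s: "s > 0"
    "((\<lambda>\<tau>. ev P (\<tau> ^ s, poly \<Psi> \<tau>) / ev D (\<tau> ^ s, poly \<Psi> \<tau>)) \<longlongrightarrow> d) (at_right 0)"
    unfolding has_arc_def by blast
  have "\<psi> (\<tau> ^ s, poly \<Psi> \<tau>) = (x0 + \<sigma> * \<tau> ^ s, y0 + \<tau> ^ s * poly ([:\<mu>:] + \<Psi>) \<tau>)" for \<tau>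
    by (simp add: \<psi>_def)
  then show thesis using that[OF \<sigma> s(1), of "[:\<mu>:] + \<Psi>"] s(2) by (simp only: P D)
qed

section \<open>Rational functions bounded near a point\<close>

lemma eventually_iterated_open:
  assumes "open N" "(a, b) \<in> N"
  shows "\<forall>\<^sub>F x in at a. \<forall>\<^sub>F y in at b. (x, y) \<in> N"
proof -
  obtain A B where AB: "open A" "open B" "a \<in> A" "b \<in> B" "A \<times> B \<subseteq> N"
    using open_prod_elim[OF assms] by (metis mem_Sigma_iff)
  have "\<forall>\<^sub>F x in at a. x \<in> A" "\<forall>\<^sub>F y in at b. y \<in> B"
    using AB by (auto intro: eventually_at_in_open')
  then show ?thesis using AB(5) by (auto elim!: eventually_mono)
qed

text \<open>
  Boundedness speaks about points of the domain only, but the inequality between polynomials extends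
  by continuity, since the zeros of the denominator have no interior.
\<close>

lemma bounded_rf_imp_numer_le_denom:
  assumes "f \<in> bounded_rf z0"
  obtains M where "\<forall>\<^sub>F z in nhds z0. \<bar>ev (numer f) z\<bar> \<le> M * \<bar>ev (denom f) z\<bar>"
proof -
  obtain U M where U: "z0 \<in> interior U" and M: "\<And>z. z \<in> U \<inter> rf_dom f \<Longrightarrow> \<bar>rf_val f z\<bar> \<le> M"
    using assms unfolding bounded_rf_def nbhds_of_def bounded_iff by auto
  have "\<bar>ev (numer f) z\<bar> \<le> M * \<bar>ev (denom f) z\<bar>" if z: "z \<in> interior U" for z
  proof (rule ccontr)
    assume less: "\<not> \<bar>ev (numer f) z\<bar> \<le> M * \<bar>ev (denom f) z\<bar>"
    define N where "N = interior U \<inter> {z. M * \<bar>ev (denom f) z\<bar> < \<bar>ev (numer f) z\<bar>}"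
    have "open N" unfolding N_def
      by (intro open_Int open_interior open_Collect_less continuous_intros continuous_ev)
    then have "\<forall>\<^sub>F x in at (fst z). \<forall>\<^sub>F y in at (snd z). (x, y) \<in> N"
      using z less by (intro eventually_iterated_open) (auto simp: N_def)
    with eventually_ev_nonzero[OF denom_nonzero[of f], of "snd z" "fst z"]
    have "\<forall>\<^sub>F x in at (fst z). \<forall>\<^sub>F y in at (snd z). (x, y) \<in> N \<and> ev (denom f) (x, y) \<noteq> 0"
      by eventually_elim (rule eventually_conj)
    from eventually_happens[OF this] obtain x
      where "\<forall>\<^sub>F y in at (snd z). (x, y) \<in> N \<and> ev (denom f) (x, y) \<noteq> 0" by auto
    from eventually_happens[OF this] obtain y where xy: "(x, y) \<in> N" "ev (denom f) (x, y) \<noteq> 0" by auto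
    have "\<bar>rf_val f (x, y)\<bar> \<le> M"
      using xy interior_subset[of U] by (intro M) (auto simp: N_def rf_dom_def)
    then show False using xy by (simp add: rf_val_def N_def abs_divide field_simps)
  qed
  then have "\<forall>\<^sub>F z in nhds z0. \<bar>ev (numer f) z\<bar> \<le> M * \<bar>ev (denom f) z\<bar>"
    unfolding eventually_nhds using U by (intro exI[of _ "interior U"]) auto
  then show thesis by (rule that)
qed

text \<open>
  The lower bound in terms of \<open>x\<close> excludes zeros off the vertical line through \<open>z0\<close>; the one for the
  exchanged variables excludes those off the horizontal line.
\<close>

lemma denominator_nonzero_punctured:
  assumes pq: "coprime p q" "q \<noteq> 0" and bnd: "\<forall>\<^sub>F z in nhds z0. \<bar>ev p z\<bar> \<le> M * \<bar>ev q z\<bar>"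
  shows "\<forall>\<^sub>F z in at z0. ev q z \<noteq> 0"
proof -
  obtain x0 y0 where z0: "z0 = (x0, y0)" by (cases z0)
  obtain c K where c: "c > 0" "\<forall>\<^sub>F z in nhds (x0, y0). c * \<bar>fst z - x0\<bar> ^ K \<le> \<bar>ev q z\<bar>"
    using denominator_lower_bound[OF pq bnd[unfolded z0]] .
  have nz': "swap_xy q \<noteq> 0" using pq(2) swap_xy_eq_0_iff by blast
  have bnd': "\<forall>\<^sub>F z in nhds (y0, x0). \<bar>ev (swap_xy p) z\<bar> \<le> M * \<bar>ev (swap_xy q) z\<bar>"
    using eventually_nhds_swap[OF bnd[unfolded z0]] by (simp add: ev_swap_xy')
  obtain c' K' where c': "c' > 0" "\<forall>\<^sub>F z in nhds (y0, x0). c' * \<bar>fst z - y0\<bar> ^ K' \<le> \<bar>ev (swap_xy q) z\<bar>"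
    using denominator_lower_bound[OF coprime_swap_xy[OF pq(1)] nz' bnd'] .
  have "\<forall>\<^sub>F z in nhds (x0, y0). z \<noteq> z0 \<longrightarrow> ev q z \<noteq> 0"
    using c(2) eventually_nhds_swap[OF c'(2)]
  proof eventually_elim
    case (elim z)
    have "0 < c * \<bar>fst z - x0\<bar> ^ K \<or> 0 < c' * \<bar>snd z - y0\<bar> ^ K'" if "z \<noteq> z0"
      using that c(1) c'(1) by (cases z) (auto simp: z0)
    then show ?case using elim by (auto simp: ev_swap_xy')
  qed
  then show ?thesis by (simp add: z0 eventually_at_filter)
qed

text \<open>
  Near \<open>z0\<close>, except possibly at \<open>z0\<close> itself, the convention on iterated limits never comes into play.
\<close>

lemma bounded_rfD:
  assumes "f \<in> bounded_rf z0"
  obtains M where "\<forall>\<^sub>F z in at z0. ev (denom f) z \<noteq> 0 \<and> z \<in> rf_dom f \<and> \<bar>rf_val f z\<bar> \<le> M"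
proof -
  obtain M where M: "\<forall>\<^sub>F z in nhds z0. \<bar>ev (numer f) z\<bar> \<le> M * \<bar>ev (denom f) z\<bar>"
    using bounded_rf_imp_numer_le_denom[OF assms] .
  have "\<forall>\<^sub>F z in at z0. \<bar>ev (numer f) z\<bar> \<le> M * \<bar>ev (denom f) z\<bar>"
    using M by (simp add: eventually_at_filter eventually_mono)
  with denominator_nonzero_punctured[OF coprime_numer_denom denom_nonzero M]
  have "\<forall>\<^sub>F z in at z0. ev (denom f) z \<noteq> 0 \<and> z \<in> rf_dom f \<and> \<bar>rf_val f z\<bar> \<le> M"
    by eventually_elim (auto simp: rf_dom_def rf_val_def abs_divide field_simps)
  then show thesis by (rule that)
qed

lemma bounded_rfI:
  assumes "\<forall>\<^sub>F z in at z0. \<bar>rf_val f z\<bar> \<le> M"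
  shows "f \<in> bounded_rf z0"
proof -
  obtain S where S: "open S" "z0 \<in> S" "\<And>z. z \<in> S \<Longrightarrow> z \<noteq> z0 \<Longrightarrow> \<bar>rf_val f z\<bar> \<le> M"
    using assms unfolding eventually_at_topological by blast
  have "bounded (insert (rf_val f z0) {- M..M})" by simp
  moreover have "rf_val f z \<in> insert (rf_val f z0) {- M..M}" if "z \<in> S" for z
    using S(3)[OF that] by (cases "z = z0") (auto simp: abs_le_iff)
  ultimately have "bounded (rf_val f ` (S \<inter> rf_dom f))"
    by (meson IntD1 bounded_subset image_subsetI)
  moreover have "S \<in> nbhds_of z0" using S(1,2) by (simp add: nbhds_of_def interior_open)
  ultimately show ?thesis unfolding bounded_rf_def by blast
qed

lemma bounded_rf_add:
  assumes "f \<in> bounded_rf z0" "g \<in> bounded_rf z0"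
  shows "f + g \<in> bounded_rf z0"
proof -
  obtain A where A: "\<forall>\<^sub>F z in at z0. ev (denom f) z \<noteq> 0 \<and> z \<in> rf_dom f \<and> \<bar>rf_val f z\<bar> \<le> A"
    using bounded_rfD[OF assms(1)] .
  obtain B where B: "\<forall>\<^sub>F z in at z0. ev (denom g) z \<noteq> 0 \<and> z \<in> rf_dom g \<and> \<bar>rf_val g z\<bar> \<le> B"
    using bounded_rfD[OF assms(2)] .
  from A B have "\<forall>\<^sub>F z in at z0. \<bar>rf_val (f + g) z\<bar> \<le> A + B"
    by eventually_elim (auto simp: rf_val_add)
  then show ?thesis by (rule bounded_rfI)
qed

lemma bounded_rf_mult:
  assumes "f \<in> bounded_rf z0" "g \<in> bounded_rf z0"
  shows "f * g \<in> bounded_rf z0"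
proof -
  obtain A where A: "\<forall>\<^sub>F z in at z0. ev (denom f) z \<noteq> 0 \<and> z \<in> rf_dom f \<and> \<bar>rf_val f z\<bar> \<le> A"
    using bounded_rfD[OF assms(1)] .
  obtain B where B: "\<forall>\<^sub>F z in at z0. ev (denom g) z \<noteq> 0 \<and> z \<in> rf_dom g \<and> \<bar>rf_val g z\<bar> \<le> B"
    using bounded_rfD[OF assms(2)] .
  from A B have "\<forall>\<^sub>F z in at z0. \<bar>rf_val (f * g) z\<bar> \<le> A * B"
    by eventually_elim (auto simp: rf_val_mult abs_mult intro!: mult_mono')
  then show ?thesis by (rule bounded_rfI)
qed

lemma bounded_rf_const: "const_rf c \<in> bounded_rf z0"
  by (rule bounded_rfI[where M = "\<bar>c\<bar>"]) (simp add: rf_val_const)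

text \<open>
  Values defined by iterated limits are approximated by honest quotients at nearby points, and the
  abscissa of those points can be chosen different from \<open>x0\<close>.  In particular the points
  differ from \<open>z0\<close>.
\<close>

lemma limiting_value_sequence:
  assumes "d \<in> limiting_values f (x0, y0)"
  obtains g :: "nat \<Rightarrow> real \<times> real" where "g \<longlonglongrightarrow> (x0, y0)" "\<And>n. fst (g n) \<noteq> x0"
    "(\<lambda>n. ev (numer f) (g n) / ev (denom f) (g n)) \<longlonglongrightarrow> d"
proof -
  let ?r = "\<lambda>z. ev (numer f) z / ev (denom f) z"
  have "\<exists>z. dist z (x0, y0) < inverse (Suc n) \<and> fst z \<noteq> x0 \<and> dist (?r z) d < 2 * inverse (Suc n)" for n
  proof -
    define \<epsilon> where "\<epsilon> = inverse (real (Suc n))"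
    have "\<epsilon> > 0" by (simp add: \<epsilon>_def)
    define V where "V = ball (x0, y0) \<epsilon>"
    have "V \<in> nbhds_of (x0, y0)" using \<open>\<epsilon> > 0\<close> by (simp add: V_def nbhds_of_def)
    then have "d \<in> closure (rf_val f ` (V \<inter> rf_dom f))" using assms unfolding limiting_values_def by blast
    then obtain w where w: "w \<in> V" "w \<in> rf_dom f" "dist (rf_val f w) d < \<epsilon>"
      using \<open>\<epsilon> > 0\<close> unfolding closure_approachable by fastforce
    obtain h where h: "\<forall>\<^sub>F x in at (fst w). ((\<lambda>y. ?r (x, y)) \<longlongrightarrow> h x) (at (snd w))"
      and hw: "(h \<longlongrightarrow> rf_val f w) (at (fst w))"
      using has_iterated_limit_rf_val[OF w(2)] unfolding has_iterated_limit_def by blast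
    have "\<forall>\<^sub>F x in at (fst w). dist (h x) d < \<epsilon>"
      using order_tendstoD(2)[OF tendsto_dist[OF hw tendsto_const] w(3)] .
    moreover have "\<forall>\<^sub>F x in at (fst w). \<forall>\<^sub>F y in at (snd w). (x, y) \<in> V"
      using w(1) by (intro eventually_iterated_open) (auto simp: V_def)
    moreover have "\<forall>\<^sub>F x in at (fst w). x \<noteq> x0" by (rule eventually_neq_at_within)
    ultimately have "\<forall>\<^sub>F x in at (fst w). x \<noteq> x0 \<and> (\<forall>\<^sub>F y in at (snd w). (x, y) \<in> V \<and> dist (?r (x, y)) d < \<epsilon>)"
      using h
    proof eventually_elim
      case (elim x)
      show ?case
        using elim eventually_conj[OF elim(2) order_tendstoD(2)[OF tendsto_dist[OF elim(4) tendsto_const] elim(1)]]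
        by blast
    qed
    from eventually_happens[OF this] obtain x where "x \<noteq> x0"
      "\<forall>\<^sub>F y in at (snd w). (x, y) \<in> V \<and> dist (?r (x, y)) d < \<epsilon>" by auto
    from eventually_happens[OF this(2)] this(1) obtain y where "x \<noteq> x0" "(x, y) \<in> V" "dist (?r (x, y)) d < \<epsilon>" by auto
    then show ?thesis
      using \<open>\<epsilon> > 0\<close> unfolding \<epsilon>_def[symmetric]
      by (intro exI[of _ "(x, y)"]) (auto simp: V_def dist_commute)
  qed
  then obtain g where g: "\<And>n. dist (g n) (x0, y0) < inverse (Suc n)" "\<And>n. fst (g n) \<noteq> x0"
    "\<And>n. dist (?r (g n)) d < 2 * inverse (Suc n)" by metis
  have "g \<longlonglongrightarrow> (x0, y0)"
    by (rule metric_tendsto_imp_tendsto[OF LIMSEQ_inverse_real_of_nat])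
      (use g(1) in \<open>auto intro!: always_eventually less_imp_le\<close>)
  moreover have "(\<lambda>n. 2 * inverse (real (Suc n))) \<longlonglongrightarrow> 0"
    using tendsto_mult_right_zero[OF LIMSEQ_inverse_real_of_nat] .
  then have "(\<lambda>n. ?r (g n)) \<longlonglongrightarrow> d"
    by (rule metric_tendsto_imp_tendsto) (use g(3) in \<open>auto intro!: always_eventually less_imp_le\<close>)
  ultimately show thesis using that g(2) by blast
qed

section \<open>Characters determined by polynomial arcs\<close>

text \<open>
  The one-variable case of \<open>bounded_quotient_tendsto_corner\<close>.
\<close>

lemma bounded_poly_quotient_tendsto:
  fixes A B :: "real poly"
  assumes "B \<noteq> 0" and bnd: "\<forall>\<^sub>F \<tau> in at_right 0. \<bar>poly A \<tau>\<bar> \<le> M * \<bar>poly B \<tau>\<bar>"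
  shows "\<exists>L. ((\<lambda>\<tau>. poly A \<tau> / poly B \<tau>) \<longlongrightarrow> L) (at_right 0)"
proof -
  obtain C where C: "B = [:- 0, 1:] ^ order 0 B * C" "\<not> [:- 0, 1:] dvd C"
    using order_decomp[OF assms(1), of 0] by blast
  have B: "poly B \<tau> = \<tau> ^ order 0 B * poly C \<tau>" for \<tau> by (subst C(1)) simp
  have ev_C: "ev [:p:] z = poly p (fst z)" for p z by (cases z) (simp add: ev_const_poly)
  have "poly C 0 \<noteq> 0" using C(2) by (simp add: poly_eq_0_iff_dvd)
  then obtain L where L: "((\<lambda>z. ev [:A:] z / (fst z ^ order 0 B * ev [:C:] z)) \<longlongrightarrow> L) corner"
    using bounded_quotient_tendsto_corner[of "[:C:]" "[:A:]" M "order 0 B"] eventually_fst_corner[OF bnd]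
    by (auto simp: ev_C B)
  have "filterlim (\<lambda>\<tau>. (\<tau>, 0)) corner (at_right 0)" by (simp add: corner_iff filterlim_ident)
  from filterlim_compose[OF L this] show ?thesis by (auto simp: ev_C B)
qed

lemma arc_limit_exists:
  fixes X Y :: "real poly"
  assumes f: "f \<in> bounded_rf z0" and arc: "filterlim (\<lambda>\<tau>. (poly X \<tau>, poly Y \<tau>)) (at z0) (at_right 0)"
  obtains L where "((\<lambda>\<tau>. rf_val f (poly X \<tau>, poly Y \<tau>)) \<longlongrightarrow> L) (at_right 0)"
proof -
  obtain A B where A: "\<And>\<tau>. poly A \<tau> = ev (numer f) (poly X \<tau>, poly Y \<tau>)"
    and B: "\<And>\<tau>. poly B \<tau> = ev (denom f) (poly X \<tau>, poly Y \<tau>)"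
    using ex_poly_compose by metis
  obtain M where "\<forall>\<^sub>F z in at z0. ev (denom f) z \<noteq> 0 \<and> z \<in> rf_dom f \<and> \<bar>rf_val f z\<bar> \<le> M"
    using bounded_rfD[OF f] .
  from eventually_compose_filterlim[OF this arc]
  have ev: "\<forall>\<^sub>F \<tau> in at_right 0. poly B \<tau> \<noteq> 0 \<and> \<bar>poly A \<tau>\<bar> \<le> M * \<bar>poly B \<tau>\<bar> \<and>
      poly A \<tau> / poly B \<tau> = rf_val f (poly X \<tau>, poly Y \<tau>)"
    by (rule eventually_mono) (auto simp: A B rf_val_def abs_divide field_simps)
  then have "B \<noteq> 0" using eventually_happens[OF ev] by auto
  moreover have "\<forall>\<^sub>F \<tau> in at_right 0. \<bar>poly A \<tau>\<bar> \<le> M * \<bar>poly B \<tau>\<bar>" using ev by (rule eventually_mono) blast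
  ultimately obtain L where "((\<lambda>\<tau>. poly A \<tau> / poly B \<tau>) \<longlongrightarrow> L) (at_right 0)"
    using bounded_poly_quotient_tendsto by blast
  then have "((\<lambda>\<tau>. rf_val f (poly X \<tau>, poly Y \<tau>)) \<longlongrightarrow> L) (at_right 0)"
    by (rule Lim_transform_eventually) (use ev in \<open>auto elim: eventually_mono\<close>)
  then show thesis by (rule that)
qed

text \<open>
  The character is evaluation in the limit along the arc.  It respects the operations because
  these are pointwise and the limits exist by \<open>arc_limit_exists\<close>.
\<close>

lemma arc_character:
  fixes X Y :: "real poly"
  assumes arc: "filterlim (\<lambda>\<tau>. (poly X \<tau>, poly Y \<tau>)) (at z0) (at_right 0)"
  obtains \<xi> where "is_character (bounded_rf z0) \<xi>"
    "\<And>f. f \<in> bounded_rf z0 \<Longrightarrow> ((\<lambda>\<tau>. rf_val f (poly X \<tau>, poly Y \<tau>)) \<longlongrightarrow> \<xi> f) (at_right 0)"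
proof -
  let ?A = "bounded_rf z0"
  define \<xi> where "\<xi> = restrict (\<lambda>f. Lim (at_right 0) (\<lambda>\<tau>. rf_val f (poly X \<tau>, poly Y \<tau>))) ?A"
  have lim: "((\<lambda>\<tau>. rf_val f (poly X \<tau>, poly Y \<tau>)) \<longlongrightarrow> \<xi> f) (at_right 0)" if f: "f \<in> ?A" for f
  proof -
    obtain L where L: "((\<lambda>\<tau>. rf_val f (poly X \<tau>, poly Y \<tau>)) \<longlongrightarrow> L) (at_right 0)"
      using arc_limit_exists[OF f arc] .
    then have "Lim (at_right 0) (\<lambda>\<tau>. rf_val f (poly X \<tau>, poly Y \<tau>)) = L"
      by (intro tendsto_Lim) auto
    then show ?thesis using L f by (simp add: \<xi>_def)
  qed
  have dom: "\<forall>\<^sub>F \<tau> in at_right 0. (poly X \<tau>, poly Y \<tau>) \<in> rf_dom f" if f: "f \<in> ?A" for f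
  proof -
    obtain M where "\<forall>\<^sub>F z in at z0. ev (denom f) z \<noteq> 0 \<and> z \<in> rf_dom f \<and> \<bar>rf_val f z\<bar> \<le> M"
      using bounded_rfD[OF f] .
    from eventually_compose_filterlim[OF this arc] show ?thesis by (rule eventually_mono) blast
  qed
  have add: "\<xi> (f + g) = \<xi> f + \<xi> g" if "f \<in> ?A" "g \<in> ?A" for f g
  proof (rule tendsto_unique[OF _ lim[OF bounded_rf_add[OF that]]])
    have "\<forall>\<^sub>F \<tau> in at_right 0. rf_val f (poly X \<tau>, poly Y \<tau>) + rf_val g (poly X \<tau>, poly Y \<tau>)
        = rf_val (f + g) (poly X \<tau>, poly Y \<tau>)"
      using dom[OF that(1)] dom[OF that(2)] by eventually_elim (simp add: rf_val_add)
    with tendsto_add[OF lim[OF that(1)] lim[OF that(2)]]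
    show "((\<lambda>\<tau>. rf_val (f + g) (poly X \<tau>, poly Y \<tau>)) \<longlongrightarrow> \<xi> f + \<xi> g) (at_right 0)"
      by (rule Lim_transform_eventually)
  qed simp
  have mult: "\<xi> (f * g) = \<xi> f * \<xi> g" if "f \<in> ?A" "g \<in> ?A" for f g
  proof (rule tendsto_unique[OF _ lim[OF bounded_rf_mult[OF that]]])
    have "\<forall>\<^sub>F \<tau> in at_right 0. rf_val f (poly X \<tau>, poly Y \<tau>) * rf_val g (poly X \<tau>, poly Y \<tau>)
        = rf_val (f * g) (poly X \<tau>, poly Y \<tau>)"
      using dom[OF that(1)] dom[OF that(2)] by eventually_elim (simp add: rf_val_mult)
    with tendsto_mult[OF lim[OF that(1)] lim[OF that(2)]]
    show "((\<lambda>\<tau>. rf_val (f * g) (poly X \<tau>, poly Y \<tau>)) \<longlongrightarrow> \<xi> f * \<xi> g) (at_right 0)"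
      by (rule Lim_transform_eventually)
  qed simp
  have const: "\<xi> (const_rf c) = c" for c
    using lim[OF bounded_rf_const, of c] by (simp add: rf_val_const tendsto_const_iff)
  have "is_character ?A \<xi>"
    unfolding is_character_def
  proof (intro conjI allI ballI)
    show "\<xi> \<in> extensional ?A" by (simp add: \<xi>_def)
    show "\<exists>f\<in>?A. \<xi> f \<noteq> 0" using bounded_rf_const[of 1] const[of 1] by (intro bexI[of _ "const_rf 1"]) simp_all
    show "\<xi> (const_rf c * f) = c * \<xi> f" if "f \<in> ?A" for c f
      using mult[OF bounded_rf_const that] const by simp
  qed (use add mult in auto)
  then show thesis using lim that by blast
qed

section \<open>From arcs to characters determined by nets\<close>

text \<open>
  The definition of type I asks for nonzero coefficients, so the terms with \<open>c k = 0\<close> have to be dropped and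
  the others renumbered; induction on \<open>n\<close> does this, with an upper bound on the exponents to keep
  them increasing.
\<close>

lemma type_I_sum:
  assumes "s > 0"
  shows "type_I (\<lambda>t. \<Sum>k<n. c k * \<bar>t\<bar> powr (1 + real k / real s))"
proof -
  have "\<exists>(N :: nat) \<phi> e. (\<forall>k\<in>{1..N}. \<phi> k \<noteq> 0 \<and> e k \<in> \<rat> \<and> 1 \<le> e k \<and> e k < 1 + real n / real s) \<and>
      strict_mono_on {1..N} e \<and>
      (\<forall>t. (\<Sum>k<n. c k * \<bar>t\<bar> powr (1 + real k / real s)) = (\<Sum>k = 1..N. \<phi> k * \<bar>t\<bar> powr e k))"
  proof (induction n)
    case 0
    show ?case by (intro exI[of _ "0 :: nat"]) (simp add: strict_mono_on_def)
  next
    case (Suc n)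
    then obtain N :: nat and \<phi> e :: "nat \<Rightarrow> real" where IH: "\<forall>k\<in>{1..N}. \<phi> k \<noteq> 0 \<and> e k \<in> \<rat> \<and> 1 \<le> e k \<and> e k < 1 + real n / real s"
      "strict_mono_on {1..N} e"
      "\<forall>t. (\<Sum>k<n. c k * \<bar>t\<bar> powr (1 + real k / real s)) = (\<Sum>k = 1..N. \<phi> k * \<bar>t\<bar> powr e k)" by blast
    have less: "1 + real n / real s < 1 + real (Suc n) / real s"
      using assms by (simp add: divide_strict_right_mono)
    show ?case
    proof (cases "c n = 0")
      case True
      then show ?thesis using IH less by (intro exI[of _ N] exI[of _ \<phi>] exI[of _ e]) fastforce
    next
      case False
      let ?\<phi> = "\<phi>(Suc N := c n)" and ?e = "e(Suc N := 1 + real n / real s)"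
      have "\<forall>k\<in>{1..Suc N}. ?\<phi> k \<noteq> 0 \<and> ?e k \<in> \<rat> \<and> 1 \<le> ?e k \<and> ?e k < 1 + real (Suc n) / real s"
      proof
        fix k assume "k \<in> {1..Suc N}"
        then consider "k \<in> {1..N}" "k \<noteq> Suc N" | "k = Suc N" by fastforce
        then show "?\<phi> k \<noteq> 0 \<and> ?e k \<in> \<rat> \<and> 1 \<le> ?e k \<and> ?e k < 1 + real (Suc n) / real s"
        proof cases
          case 1
          then show ?thesis using bspec[OF IH(1) 1(1)] less by auto
        qed (use less False in auto)
      qed
      moreover have "strict_mono_on {1..Suc N} ?e"
        using IH(1,2) by (auto simp: strict_mono_on_def le_Suc_eq)
      moreover have "(\<Sum>k<Suc n. c k * \<bar>t\<bar> powr (1 + real k / real s)) = (\<Sum>k = 1..Suc N. ?\<phi> k * \<bar>t\<bar> powr ?e k)" for t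
      proof -
        have "(\<Sum>k = 1..N. ?\<phi> k * \<bar>t\<bar> powr ?e k) = (\<Sum>k = 1..N. \<phi> k * \<bar>t\<bar> powr e k)"
          by (intro sum.cong) auto
        then show ?thesis using IH(3) by simp
      qed
      ultimately show ?thesis by blast
    qed
  qed
  then show ?thesis unfolding type_I_def by blast
qed

lemma directed_nat: "directed UNIV ((\<le>) :: nat \<Rightarrow> nat \<Rightarrow> bool)"
  unfolding directed_def by (auto intro: order_trans) (metis nat_le_linear)

lemma tails_nat: "tails UNIV ((\<le>) :: nat \<Rightarrow> nat \<Rightarrow> bool) = sequentially"
  by (simp add: filter_eq_iff eventually_tails[OF directed_nat] eventually_sequentially)

text \<open>
  On the arc \<open>\<bar>u - u0\<bar> = \<tau>^s\<close>, so \<open>\<tau>^s \<Theta>(\<tau>)\<close> is a sum of powers of \<open>\<bar>u - u0\<bar>\<close> with exponents \<open>1 + k / s\<close>.  The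
  arc lies on the graph of this function of type I, and the differences in question are exactly 0.
\<close>

lemma approach_arc:
  fixes \<tau> :: "nat \<Rightarrow> real"
  assumes \<tau>: "filterlim \<tau> (at_right 0) sequentially" and pos: "\<And>n. \<tau> n > 0"
    and \<sigma>: "\<sigma> = 1 \<or> \<sigma> = - 1" and s: "s > 0"
  shows "approach UNIV (\<le>) (\<lambda>n. u0 + \<sigma> * \<tau> n ^ s) (\<lambda>n. v0 + \<tau> n ^ s * poly \<Theta> (\<tau> n)) u0 v0"
  unfolding approach_def tails_nat
proof (intro conjI)
  show "(\<forall>n\<in>UNIV. u0 < u0 + \<sigma> * \<tau> n ^ s) \<or> (\<forall>n\<in>UNIV. u0 + \<sigma> * \<tau> n ^ s < u0)"
    using \<sigma> pos by auto
next
  have "\<tau> \<longlonglongrightarrow> 0" using \<tau> by (simp add: filterlim_at)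
  then have "(\<lambda>n. poly \<Theta> (\<tau> n) / \<sigma>) \<longlonglongrightarrow> poly \<Theta> 0 / \<sigma>" using \<sigma> by (intro tendsto_intros) auto
  moreover have "(v0 + \<tau> n ^ s * poly \<Theta> (\<tau> n) - v0) / (u0 + \<sigma> * \<tau> n ^ s - u0) = poly \<Theta> (\<tau> n) / \<sigma>" for n
    using pos[of n] by simp
  ultimately show "\<exists>m. (\<lambda>n. (v0 + \<tau> n ^ s * poly \<Theta> (\<tau> n) - v0) / (u0 + \<sigma> * \<tau> n ^ s - u0)) \<longlonglongrightarrow> m"
    by auto
next
  define \<Phi> where "\<Phi> t = (\<Sum>k<Suc (degree \<Theta>). coeff \<Theta> k * \<bar>t\<bar> powr (1 + real k / real s))" for t
  have "\<Phi> (u0 + \<sigma> * \<tau> n ^ s - u0) = \<tau> n ^ s * poly \<Theta> (\<tau> n)" for n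
  proof -
    have "\<bar>\<sigma> * \<tau> n ^ s\<bar> = \<tau> n ^ s" using \<sigma> pos[of n] by auto
    moreover have "(\<tau> n ^ s) powr (1 + real k / real s) = \<tau> n ^ s * \<tau> n ^ k" for k
      using pos[of n] s by (simp add: powr_add powr_powr flip: powr_realpow)
    ultimately show ?thesis
      by (simp only: \<Phi>_def poly_altdef sum_distrib_left lessThan_Suc_atMost add_diff_cancel_left' mult_ac)
  qed
  then show "\<exists>\<Phi>. type_I \<Phi> \<and> (\<forall>e. (\<lambda>n. (v0 + \<tau> n ^ s * poly \<Theta> (\<tau> n) - v0 - \<Phi> (u0 + \<sigma> * \<tau> n ^ s - u0))
        / \<bar>u0 + \<sigma> * \<tau> n ^ s - u0\<bar> powr e) \<longlonglongrightarrow> 0)"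
    using type_I_sum[OF s] by (intro exI[of _ \<Phi>]) (simp add: \<Phi>_def[abs_def] del: sum.lessThan_Suc)
qed

lemma X1_of_arc:
  fixes X Y :: "real poly"
  assumes f: "f \<in> bounded_rf z"
    and arc: "filterlim (\<lambda>\<tau>. (poly X \<tau>, poly Y \<tau>)) (at z) (at_right 0)"
    and d: "((\<lambda>\<tau>. ev (numer f) (poly X \<tau>, poly Y \<tau>) / ev (denom f) (poly X \<tau>, poly Y \<tau>)) \<longlongrightarrow> d) (at_right 0)"
    and app: "\<And>\<tau> :: nat \<Rightarrow> real. filterlim \<tau> (at_right 0) sequentially \<Longrightarrow> (\<And>n. \<tau> n > 0) \<Longrightarrow>
      approach UNIV (\<le>) (\<lambda>n. poly X (\<tau> n)) (\<lambda>n. poly Y (\<tau> n)) (fst z) (snd z) \<or>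
      approach UNIV (\<le>) (\<lambda>n. poly Y (\<tau> n)) (\<lambda>n. poly X (\<tau> n)) (snd z) (fst z)"
  shows "\<exists>\<xi> \<in> X1 z. \<xi> f = d"
proof -
  obtain \<xi> where \<xi>: "is_character (bounded_rf z) \<xi>"
    and lim: "\<And>f. f \<in> bounded_rf z \<Longrightarrow> ((\<lambda>\<tau>. rf_val f (poly X \<tau>, poly Y \<tau>)) \<longlongrightarrow> \<xi> f) (at_right 0)"
    using arc_character[OF arc] by metis
  define \<tau> where "\<tau> n = inverse (real (Suc n))" for n
  have \<tau>: "filterlim \<tau> (at_right 0) sequentially" and pos: "\<tau> n > 0" for n
    using LIMSEQ_inverse_real_of_nat by (auto simp: \<tau>_def[abs_def] filterlim_at)
  have "((\<lambda>n. (poly X (\<tau> n), poly Y (\<tau> n))) \<longlongrightarrow> z) sequentially"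
    using filterlim_compose[OF arc \<tau>] by (simp add: filterlim_at)
  then have "X1_net UNIV (\<le>) (\<lambda>n. poly X (\<tau> n)) (\<lambda>n. poly Y (\<tau> n)) z \<xi>"
    unfolding X1_net_def determines_def tails_nat
    using app[OF \<tau> pos] filterlim_compose[OF lim \<tau>]
    by (simp add: directed_nat)
  then have "\<xi> \<in> X1 z" by (rule X1_I[OF \<xi>])
  moreover have "\<xi> f = d"
  proof (rule tendsto_unique[OF _ lim[OF f]])
    obtain M where "\<forall>\<^sub>F z in at z. ev (denom f) z \<noteq> 0 \<and> z \<in> rf_dom f \<and> \<bar>rf_val f z\<bar> \<le> M"
      using bounded_rfD[OF f] .
    from eventually_compose_filterlim[OF this arc]
    have "\<forall>\<^sub>F \<tau> in at_right 0. ev (numer f) (poly X \<tau>, poly Y \<tau>) / ev (denom f) (poly X \<tau>, poly Y \<tau>)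
        = rf_val f (poly X \<tau>, poly Y \<tau>)"
      by (rule eventually_mono) (simp add: rf_val_def)
    with d show "((\<lambda>\<tau>. rf_val f (poly X \<tau>, poly Y \<tau>)) \<longlongrightarrow> d) (at_right 0)"
      by (rule Lim_transform_eventually)
  qed simp
  ultimately show ?thesis by blast
qed

lemma poly_arc:
  assumes "s > 0" "\<sigma> = 1 \<or> \<sigma> = - 1"
  obtains X Y :: "real poly" where "\<forall>\<tau>. poly X \<tau> = u0 + \<sigma> * \<tau> ^ s" "\<forall>\<tau>. poly Y \<tau> = v0 + \<tau> ^ s * poly \<Theta> \<tau>"
    "filterlim (\<lambda>\<tau>. (poly X \<tau>, poly Y \<tau>)) (at (u0, v0)) (at_right 0)"
    "filterlim (\<lambda>\<tau>. (poly Y \<tau>, poly X \<tau>)) (at (v0, u0)) (at_right 0)"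
proof -
  define X where "X = [:u0:] + monom \<sigma> s"
  define Y where "Y = [:v0:] + monom 1 s * \<Theta>"
  have XY: "poly X \<tau> = u0 + \<sigma> * \<tau> ^ s" "poly Y \<tau> = v0 + \<tau> ^ s * poly \<Theta> \<tau>" for \<tau>
    by (simp_all add: X_def Y_def poly_monom)
  have cont: "(poly p \<longlongrightarrow> poly p 0) (at_right 0)" for p :: "real poly"
    by (rule tendsto_mono[OF at_le[OF subset_UNIV]]) (use poly_isCont in \<open>simp add: isCont_def\<close>)
  have "(poly X \<longlongrightarrow> u0) (at_right 0)" "(poly Y \<longlongrightarrow> v0) (at_right 0)"
    using cont[of X] cont[of Y] assms(1) by (simp_all add: XY zero_power)
  moreover have "\<forall>\<^sub>F \<tau> in at_right 0. poly X \<tau> \<noteq> u0"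
    using eventually_at_right_less[of 0] by (rule eventually_mono) (use assms(2) in \<open>auto simp: XY\<close>)
  ultimately have "filterlim (\<lambda>\<tau>. (poly X \<tau>, poly Y \<tau>)) (at (u0, v0)) (at_right 0)"
    "filterlim (\<lambda>\<tau>. (poly Y \<tau>, poly X \<tau>)) (at (v0, u0)) (at_right 0)"
    by (auto simp: filterlim_at intro!: tendsto_Pair elim: eventually_mono)
  then show thesis using that XY by blast
qed

section \<open>Limiting values are values of characters\<close>

text \<open>
  One of the two cones contains infinitely many points of the sequence.  In the second cone the
  variables are exchanged before the arc is selected.
\<close>

theorem theorem4:
  fixes x0 y0 d :: real and f :: ratfun
  assumes "f \<in> bounded_rf (x0, y0)"
    and "d \<in> limiting_values f (x0, y0)"
  shows "\<exists>\<xi> \<in> X1 (x0, y0). \<xi> f = d"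
proof -
  define p q where "p = numer f" and "q = denom f"
  have pq: "coprime p q" "q \<noteq> 0" by (simp_all add: p_def q_def coprime_numer_denom denom_nonzero)
  obtain M where M: "\<forall>\<^sub>F z in nhds (x0, y0). \<bar>ev p z\<bar> \<le> M * \<bar>ev q z\<bar>"
    using bounded_rf_imp_numer_le_denom[OF assms(1)] unfolding p_def q_def .
  obtain g where g: "g \<longlonglongrightarrow> (x0, y0)" "\<And>n. fst (g n) \<noteq> x0" and gd: "(\<lambda>n. ev p (g n) / ev q (g n)) \<longlonglongrightarrow> d"
    using limiting_value_sequence[OF assms(2)] unfolding p_def q_def by blast
  have sub: "(\<lambda>n. g (r n)) \<longlonglongrightarrow> (x0, y0)" "(\<lambda>n. ev p (g (r n)) / ev q (g (r n))) \<longlonglongrightarrow> d"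
    if "strict_mono r" for r
    using filterlim_compose[OF g(1) filterlim_subseq[OF that]] filterlim_compose[OF gd filterlim_subseq[OF that]] .
  define S where "S = {n. \<bar>snd (g n) - y0\<bar> \<le> \<bar>fst (g n) - x0\<bar>}"
  have "infinite S \<or> infinite (- S)" using infinite_UNIV_nat finite_Un[of S "- S"] by (simp add: Compl_partition)
  then show ?thesis
  proof
    assume "infinite S"
    then obtain r :: "nat \<Rightarrow> nat" where r: "strict_mono r" "\<And>n. r n \<in> S" using infinite_enumerate by blast
    obtain \<sigma> s \<Theta> where arc: "\<sigma> = 1 \<or> \<sigma> = - 1" "s > 0"
      "((\<lambda>\<tau>. ev p (x0 + \<sigma> * \<tau> ^ s, y0 + \<tau> ^ s * poly \<Theta> \<tau>) / ev q (x0 + \<sigma> * \<tau> ^ s, y0 + \<tau> ^ s * poly \<Theta> \<tau>)) \<longlongrightarrow> d)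
         (at_right 0)"
    proof (rule arc_selection_in_cone[OF pq M, of "\<lambda>n. fst (g (r n))" "\<lambda>n. snd (g (r n))"])
      show "(\<lambda>n. fst (g (r n))) \<longlonglongrightarrow> x0" using tendsto_fst[OF sub(1)[OF r(1)]] by simp
    qed (use g(2) r(2) sub(2)[OF r(1)] in \<open>auto simp: S_def\<close>)
    obtain X Y :: "real poly" where XY: "\<forall>\<tau>. poly X \<tau> = x0 + \<sigma> * \<tau> ^ s" "\<forall>\<tau>. poly Y \<tau> = y0 + \<tau> ^ s * poly \<Theta> \<tau>"
      "filterlim (\<lambda>\<tau>. (poly X \<tau>, poly Y \<tau>)) (at (x0, y0)) (at_right 0)"
      "filterlim (\<lambda>\<tau>. (poly Y \<tau>, poly X \<tau>)) (at (y0, x0)) (at_right 0)"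
      using poly_arc[OF arc(2,1), of x0 y0 \<Theta>] .
    show ?thesis
      using arc approach_arc[OF _ _ arc(1,2)]
      by (intro X1_of_arc[OF assms(1) XY(3)]) (simp_all add: XY p_def q_def)
  next
    assume "infinite (- S)"
    then obtain r :: "nat \<Rightarrow> nat" where r: "strict_mono r" "\<And>n. r n \<in> - S" using infinite_enumerate by blast
    have nz': "swap_xy q \<noteq> 0" using pq(2) swap_xy_eq_0_iff by blast
    have bnd': "\<forall>\<^sub>F z in nhds (y0, x0). \<bar>ev (swap_xy p) z\<bar> \<le> M * \<bar>ev (swap_xy q) z\<bar>"
      using eventually_nhds_swap[OF M] by (simp add: ev_swap_xy')
    obtain \<sigma> s \<Theta> where arc: "\<sigma> = 1 \<or> \<sigma> = - 1" "s > 0"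
      "((\<lambda>\<tau>. ev (swap_xy p) (y0 + \<sigma> * \<tau> ^ s, x0 + \<tau> ^ s * poly \<Theta> \<tau>)
          / ev (swap_xy q) (y0 + \<sigma> * \<tau> ^ s, x0 + \<tau> ^ s * poly \<Theta> \<tau>)) \<longlongrightarrow> d) (at_right 0)"
    proof (rule arc_selection_in_cone[OF coprime_swap_xy[OF pq(1)] nz' bnd', of "\<lambda>n. snd (g (r n))" "\<lambda>n. fst (g (r n))"])
      show "(\<lambda>n. snd (g (r n))) \<longlonglongrightarrow> y0" using tendsto_snd[OF sub(1)[OF r(1)]] by simp
      show "snd (g (r n)) \<noteq> y0" "\<bar>fst (g (r n)) - x0\<bar> \<le> \<bar>snd (g (r n)) - y0\<bar>" for n
        using r(2)[of n] by (auto simp: S_def)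
    qed (use sub(2)[OF r(1)] in \<open>auto simp: ev_swap_xy\<close>)
    obtain Y X :: "real poly" where XY: "\<forall>\<tau>. poly Y \<tau> = y0 + \<sigma> * \<tau> ^ s" "\<forall>\<tau>. poly X \<tau> = x0 + \<tau> ^ s * poly \<Theta> \<tau>"
      "filterlim (\<lambda>\<tau>. (poly Y \<tau>, poly X \<tau>)) (at (y0, x0)) (at_right 0)"
      "filterlim (\<lambda>\<tau>. (poly X \<tau>, poly Y \<tau>)) (at (x0, y0)) (at_right 0)"
      using poly_arc[OF arc(2,1), of y0 x0 \<Theta>] .
    show ?thesis
      using arc approach_arc[OF _ _ arc(1,2)]
      by (intro X1_of_arc[OF assms(1) XY(4)]) (simp_all add: XY p_def q_def ev_swap_xy)
  qed
qed

end
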